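(* Let $n\geq m\geq 1$ be integers, let $K$ be a field, $S=K[x_1,\ldots,x_{n+m}]$ and $I=(x_1,\ldots,x_n)\cap(x_{n+1},\ldots,x_{n+m})\subset S$. Then: (1) $m\geq \operatorname{sdepth}(S/I)\geq \min\{m,\lceil \frac{n}{2}\rceil\}$. (2) $m+\lceil \frac{n}{2}\rceil\geq \operatorname{sdepth}(I)\geq \lceil \frac{n}{2}\rceil+\lceil \frac{m}{2}\rceil$. (3) If $n\geq 2m-1$ then $\operatorname{sdepth}(S/I)=m$.
   Context: Stanley depth: let $S=K[x_1,\ldots,x_p]$ be a polynomial ring over a field $K$ and $M$ a $\mathbb Z^p$-graded $S$-module. A Stanley decomposition of $M$ is a direct sum decomposition $\mathcal D: M=\bigoplus_{i=1}^r m_iK[Z_i]$ as a $\mathbb Z^p$-graded $K$-vector space, where each $m_i\in M$ is homogeneous with respect to the $\mathbb Z^p$-grading, $Z_i\subset\{x_1,\ldots,x_p\}$, and $m_iK[Z_i]=\{um_i: u\in K[Z_i]\}\subset M$ is a free $K[Z_i]$-submodule. Put $\operatorname{sdepth}(\mathcal D)=\min_i|Z_i|$ and $\operatorname{sdepth}(M)=\max\{\operatorname{sdepth}(\mathcal D):\mathcal D$ a Stanley decomposition of $M\}$. *)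

theory Defs
  imports Complex_Main "HOL-Algebra.Module" "HOL-Algebra.QuotRing" "HOL-Library.Poly_Mapping"
begin

type_synonym 'k mpoly = "(nat \<Rightarrow>\<^sub>0 nat) \<Rightarrow>\<^sub>0 'k"

text \<open>For a set \<open>Z\<close> of variable indices, \<open>poly_ring Z\<close> is \<open>K[x\<^sub>i : i \<in> Z]\<close>; the field
  \<open>K\<close> is the type \<open>'k\<close>, and \<open>S = K[x\<^sub>1,\<dots>,x\<^sub>p]\<close> is \<open>poly_ring {1..p}\<close>.\<close>

definition poly_ring :: "nat set \<Rightarrow> 'k::field mpoly ring" where
  "poly_ring Z =
     \<lparr>carrier = {f. \<forall>b\<in>Poly_Mapping.keys f. Poly_Mapping.keys b \<subseteq> Z},
      monoid.mult = (*), one = 1, ring.zero = 0, add = (+)\<rparr>"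

definition var :: "nat \<Rightarrow> 'k::field mpoly" where
  "var i = Poly_Mapping.single (Poly_Mapping.single i 1) 1"

text \<open>The group \<open>\<int>\<^sup>p\<close>, with coordinates indexed by \<open>{1..p}\<close> and extended by \<open>0\<close>.\<close>

definition degrees :: "nat \<Rightarrow> (nat \<Rightarrow> int) set" where
  "degrees p = {a. \<forall>i. i \<notin> {1..p} \<longrightarrow> a i = 0}"

definition exponent_degree :: "(nat \<Rightarrow>\<^sub>0 nat) \<Rightarrow> nat \<Rightarrow> int" where
  "exponent_degree b = (\<lambda>i. int (Poly_Mapping.lookup b i))"

text \<open>The degree \<open>a\<close> component of the polynomial ring: \<open>K x\<^sup>a\<close>, or \<open>0\<close> if \<open>a\<close> has a negative entry.\<close>

definition poly_component :: "(nat \<Rightarrow> int) \<Rightarrow> 'k::field mpoly set" where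
  "poly_component a = {f. \<forall>b\<in>Poly_Mapping.keys f. exponent_degree b = a}"

text \<open>Internal direct sum of a possibly infinite family of additive subgroups: every element is
  in a unique way a sum of a finitely supported family of elements of the summands. Families are
  extensional functions, so that uniqueness is meaningful.\<close>

definition direct_sum :: "('a, 'b) ring_scheme \<Rightarrow> 'i set \<Rightarrow> ('i \<Rightarrow> 'a set) \<Rightarrow> bool" where
  "direct_sum M A F \<longleftrightarrow>
     (\<forall>i\<in>A. additive_subgroup (F i) M) \<and>
     (\<forall>x\<in>carrier M. \<exists>!f. f \<in> (\<Pi>\<^sub>E i\<in>A. F i) \<and> finite {i\<in>A. f i \<noteq> \<zero>\<^bsub>M\<^esub>} \<and>
        x = (\<Oplus>\<^bsub>M\<^esub>i\<in>{i\<in>A. f i \<noteq> \<zero>\<^bsub>M\<^esub>}. f i))"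

locale multigraded_module = module "poly_ring {1..p}" M
  for p :: nat and M :: "('k::field mpoly, 'm) module" (structure) +
  fixes component :: "(nat \<Rightarrow> int) \<Rightarrow> 'm set"
  assumes direct_sum_components: "direct_sum M (degrees p) component"
    and smult_component:
      "\<lbrakk>a \<in> degrees p; b \<in> degrees p; f \<in> poly_component a; x \<in> component b\<rbrakk>
        \<Longrightarrow> f \<odot> x \<in> component (\<lambda>i. a i + b i)"
begin

definition homogeneous :: "'m \<Rightarrow> bool" where
  "homogeneous x \<longleftrightarrow> (\<exists>a\<in>degrees p. x \<in> component a)"

definition stanley_space :: "'m \<Rightarrow> nat set \<Rightarrow> 'm set" where
  "stanley_space x Z = (\<lambda>u. u \<odot> x) ` carrier (poly_ring Z)"

text \<open>A decomposition is the list of the pairs \<open>(m\<^sub>i, Z\<^sub>i)\<close>. As \<open>m\<^sub>i\<close> is homogeneous, \<open>m\<^sub>i K[Z\<^sub>i]\<close>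
  is a graded \<open>K\<close>-subspace, so an internal direct sum of the underlying groups is already one
  of \<open>\<int>\<^sup>p\<close>-graded vector spaces. Freeness of \<open>m\<^sub>i K[Z\<^sub>i]\<close> over \<open>K[Z\<^sub>i]\<close> says that \<open>m\<^sub>i\<close> has
  zero annihilator there (in particular \<open>m\<^sub>i\<close> is nonzero).\<close>

definition stanley_decomposition :: "('m \<times> nat set) list \<Rightarrow> bool" where
  "stanley_decomposition D \<longleftrightarrow>
     (\<forall>(x, Z)\<in>set D. homogeneous x \<and> Z \<subseteq> {1..p} \<and>
        (\<forall>u\<in>carrier (poly_ring Z). u \<odot> x = \<zero> \<longrightarrow> u = 0)) \<and>
     direct_sum M {..<length D} (\<lambda>i. stanley_space (fst (D ! i)) (snd (D ! i)))"

definition sdepth_decomposition :: "('m \<times> nat set) list \<Rightarrow> nat" where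
  "sdepth_decomposition D = Min ((\<lambda>(x, Z). card Z) ` set D)"

text \<open>The maximum is over a finite set of values; for \<open>M = 0\<close>, whose only decomposition is
  the empty one, the value is unspecified.\<close>

definition sdepth :: nat where
  "sdepth = Max {sdepth_decomposition D |D. stanley_decomposition D}"

end

definition ideal_module :: "('a, 'b) ring_scheme \<Rightarrow> 'a set \<Rightarrow> ('a, 'a) module" where
  "ideal_module R I =
     \<lparr>carrier = I, monoid.mult = monoid.mult R, one = one R, ring.zero = ring.zero R,
      add = add R, smult = monoid.mult R\<rparr>"

definition quotient_module :: "('a, 'b) ring_scheme \<Rightarrow> 'a set \<Rightarrow> ('a, 'a set) module" where
  "quotient_module R I =
     \<lparr>carrier = carrier (R Quot I), monoid.mult = monoid.mult (R Quot I), one = one (R Quot I),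
      ring.zero = ring.zero (R Quot I), add = add (R Quot I),
      smult = (\<lambda>r X. (I +>\<^bsub>R\<^esub> r) \<otimes>\<^bsub>R Quot I\<^esub> X)\<rparr>"

definition ideal_component :: "'k::field mpoly set \<Rightarrow> (nat \<Rightarrow> int) \<Rightarrow> 'k mpoly set" where
  "ideal_component I a = I \<inter> poly_component a"

definition quotient_component ::
  "nat \<Rightarrow> 'k::field mpoly set \<Rightarrow> (nat \<Rightarrow> int) \<Rightarrow> 'k mpoly set set" where
  "quotient_component p I a = (\<lambda>f. I +>\<^bsub>poly_ring {1..p}\<^esub> f) ` poly_component a"


subsection \<open>Multigraded ideals and their quotients are multigraded modules\<close>

declare One_nat_def [simp del]

lemma poly_ring_simps [simp]:
  "monoid.mult (poly_ring Z) = (*)" "one (poly_ring Z) = 1" "ring.zero (poly_ring Z) = 0"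
  "add (poly_ring Z) = (+)"
  by (simp_all add: poly_ring_def)

lemma carrier_poly_ring:
  "f \<in> carrier (poly_ring Z) \<longleftrightarrow> (\<forall>b\<in>Poly_Mapping.keys f. Poly_Mapping.keys b \<subseteq> Z)"
  by (simp add: poly_ring_def)

lemma poly_ring_add_closed:
  "f \<in> carrier (poly_ring Z) \<Longrightarrow> g \<in> carrier (poly_ring Z) \<Longrightarrow> f + g \<in> carrier (poly_ring Z)"
  unfolding carrier_poly_ring using keys_add[of f g] by (meson UnE subsetD)

lemma poly_ring_mult_closed:
  assumes "f \<in> carrier (poly_ring Z)" "g \<in> carrier (poly_ring Z)"
  shows "f * g \<in> carrier (poly_ring Z)"
  unfolding carrier_poly_ring
proof
  fix b assume "b \<in> Poly_Mapping.keys (f * g)"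
  then obtain c d where "b = c + d" "c \<in> Poly_Mapping.keys f" "d \<in> Poly_Mapping.keys g"
    using keys_mult[of f g] by blast
  then show "Poly_Mapping.keys b \<subseteq> Z"
    using assms keys_add[of c d] unfolding carrier_poly_ring by (metis Un_least subset_trans)
qed

lemma poly_ring_uminus_closed:
  "f \<in> carrier (poly_ring Z) \<Longrightarrow> - f \<in> carrier (poly_ring Z)"
  unfolding carrier_poly_ring by (simp add: in_keys_iff)

lemma poly_ring_01_closed: "0 \<in> carrier (poly_ring Z)" "1 \<in> carrier (poly_ring Z)"
  by (simp_all add: carrier_poly_ring)

lemma cring_poly_ring: "cring (poly_ring Z :: 'k::field mpoly ring)"
proof -
  have "\<exists>g\<in>carrier (poly_ring Z). g + f = 0" if "f \<in> carrier (poly_ring Z)" for f :: "'k mpoly"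
    by (rule bexI[of _ "- f"]) (simp, rule poly_ring_uminus_closed[OF that])
  then show ?thesis
    by (intro cringI abelian_groupI comm_monoidI)
       (simp_all only: poly_ring_simps poly_ring_01_closed poly_ring_add_closed poly_ring_mult_closed add_ac
          mult_ac add_0_left add_0_right mult_1_left mult_1_right distrib_right distrib_left)
qed

lemma poly_ring_a_inv:
  assumes "(f :: 'k::field mpoly) \<in> carrier (poly_ring Z)"
  shows "\<ominus>\<^bsub>poly_ring Z\<^esub> f = - f"
proof -
  interpret cring "poly_ring Z :: 'k mpoly ring" by (rule cring_poly_ring)
  show ?thesis
    by (rule minus_equality) (simp_all add: assms poly_ring_uminus_closed)
qed

lemma inj_exponent_degree: "inj exponent_degree"
proof (intro injI poly_mapping_eqI)
  fix b c i assume "exponent_degree b = exponent_degree c"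
  from fun_cong[OF this, of i] show "Poly_Mapping.lookup b i = Poly_Mapping.lookup c i"
    by (simp add: exponent_degree_def)
qed

lemma exponent_degree_in_degrees: "exponent_degree b \<in> degrees p \<longleftrightarrow> Poly_Mapping.keys b \<subseteq> {1..p}"
  by (auto simp: degrees_def exponent_degree_def in_keys_iff subset_iff)

lemma poly_component_subset: "a \<in> degrees p \<Longrightarrow> poly_component a \<subseteq> carrier (poly_ring {1..p})"
  by (auto simp only: poly_component_def carrier_poly_ring exponent_degree_in_degrees[symmetric])

lemma poly_component_mult:
  assumes "f \<in> poly_component a" "g \<in> poly_component b"
  shows "f * g \<in> poly_component (\<lambda>i. a i + b i)"
  unfolding poly_component_def mem_Collect_eq
proof
  fix e assume "e \<in> Poly_Mapping.keys (f * g)"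
  then obtain c d where "e = c + d" "c \<in> Poly_Mapping.keys f" "d \<in> Poly_Mapping.keys g"
    using keys_mult[of f g] by blast
  moreover have "exponent_degree c = a" "exponent_degree d = b"
    using assms calculation by (auto simp: poly_component_def)
  ultimately show "exponent_degree e = (\<lambda>i. a i + b i)"
    by (auto simp: exponent_degree_def lookup_add)
qed

lemma direct_sumI:
  fixes M (structure)
  assumes "abelian_group M"
    and sub: "\<And>i. i \<in> A \<Longrightarrow> additive_subgroup (F i) M"
    and ex: "\<And>x. x \<in> carrier M \<Longrightarrow>
      \<exists>B f. finite B \<and> B \<subseteq> A \<and> (\<forall>i\<in>B. f i \<in> F i) \<and> x = (\<Oplus>i\<in>B. f i)"
    and zero: "\<And>B f. \<lbrakk>finite B; B \<subseteq> A; \<And>i. i \<in> B \<Longrightarrow> f i \<in> F i; (\<Oplus>i\<in>B. f i) = \<zero>\<rbrakk>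
      \<Longrightarrow> \<forall>i\<in>B. f i = \<zero>"
  shows "direct_sum M A F"
proof -
  interpret abelian_group M by fact
  have sc: "x \<in> carrier M" if "i \<in> A" "x \<in> F i" for i x
    using additive_subgroup.a_subset[OF sub[OF that(1)]] that(2) by blast
  let ?R = "\<lambda>x f. f \<in> (\<Pi>\<^sub>E i\<in>A. F i) \<and> finite {i\<in>A. f i \<noteq> \<zero>} \<and> x = (\<Oplus>i\<in>{i\<in>A. f i \<noteq> \<zero>}. f i)"
  have "\<exists>!f. ?R x f" if x: "x \<in> carrier M" for x
  proof (rule ex_ex1I)
    obtain B f where B: "finite B" "B \<subseteq> A" "\<forall>i\<in>B. f i \<in> F i" "x = (\<Oplus>i\<in>B. f i)"
      using ex[OF x] by blast
    define g where "g = (\<lambda>i\<in>A. if i \<in> B then f i else \<zero>)"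
    have s: "{i\<in>A. g i \<noteq> \<zero>} \<subseteq> B" by (auto simp: g_def)
    have "(\<Oplus>i\<in>{i\<in>A. g i \<noteq> \<zero>}. g i) = (\<Oplus>i\<in>B. f i)"
      by (rule add.finprod_mono_neutral_cong_left[OF B(1) s])
         (use B sc in \<open>auto simp: g_def\<close>)
    moreover have "g \<in> (\<Pi>\<^sub>E i\<in>A. F i)"
      using B(3) additive_subgroup.zero_closed[OF sub] by (auto simp: g_def)
    ultimately show "\<exists>f. ?R x f"
      using B(4) finite_subset[OF s B(1)] by (intro exI[of _ g]) auto
  next
    fix f g assume f: "?R x f" and g: "?R x g"
    define B where "B = {i\<in>A. f i \<noteq> \<zero>} \<union> {i\<in>A. g i \<noteq> \<zero>}"
    have B: "finite B" "B \<subseteq> A" using f g by (auto simp: B_def)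
    have fF: "f i \<in> F i" "g i \<in> F i" if "i \<in> A" for i using f g that by auto
    have c: "f i \<in> carrier M" "g i \<in> carrier M" if "i \<in> A" for i
      using fF sc that by auto
    have 1: "(\<Oplus>i\<in>{i\<in>A. f i \<noteq> \<zero>}. f i) = (\<Oplus>i\<in>B. f i)"
      by (rule add.finprod_mono_neutral_cong_left[OF B(1)]) (use c in \<open>auto simp: B_def\<close>)
    have 2: "(\<Oplus>i\<in>{i\<in>A. g i \<noteq> \<zero>}. g i) = (\<Oplus>i\<in>B. g i)"
      by (rule add.finprod_mono_neutral_cong_left[OF B(1)]) (use c in \<open>auto simp: B_def\<close>)
    have eq: "(\<Oplus>i\<in>B. f i) = (\<Oplus>i\<in>B. g i)" using f g by (simp add: 1[symmetric] 2[symmetric])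
    have cB: "f \<in> B \<rightarrow> carrier M" "g \<in> B \<rightarrow> carrier M" using c B(2) by auto
    have "(\<Oplus>i\<in>B. f i \<ominus> g i) \<oplus> (\<Oplus>i\<in>B. g i) = (\<Oplus>i\<in>B. (f i \<ominus> g i) \<oplus> g i)"
      using cB by (intro finsum_addf[symmetric]) auto
    also have "\<dots> = (\<Oplus>i\<in>B. f i)"
      using cB by (intro finsum_cong') (auto simp: a_minus_def a_assoc l_neg Pi_iff)
    finally have "(\<Oplus>i\<in>B. f i \<ominus> g i) \<oplus> (\<Oplus>i\<in>B. g i) = \<zero> \<oplus> (\<Oplus>i\<in>B. g i)"
      using eq cB by simp
    moreover have "(\<Oplus>i\<in>B. g i) \<in> carrier M" "(\<Oplus>i\<in>B. f i \<ominus> g i) \<in> carrier M"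
      using cB by (auto intro!: finsum_closed)
    ultimately have "(\<Oplus>i\<in>B. f i \<ominus> g i) = \<zero>"
      using add.right_cancel by blast
    then have "\<forall>i\<in>B. f i \<ominus> g i = \<zero>"
      using additive_subgroup.a_closed[OF sub] additive_subgroup.a_inv_closed[OF sub] fF B(2)
      by (intro zero[OF B]) (auto simp: a_minus_def subset_iff)
    moreover have "(f i \<ominus> g i) \<oplus> g i = f i" if "i \<in> B" for i
      using that cB by (auto simp: a_minus_def a_assoc l_neg Pi_iff)
    ultimately have "f i = g i" if "i \<in> B" for i
      using that cB(2) l_zero[of "g i"] by (auto simp: Pi_iff)
    then have "f i = g i" if "i \<in> A" for i
      using that by (cases "i \<in> B") (auto simp: B_def)
    then show "f = g" using f g by (intro PiE_ext[of f A F g]) auto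
  qed
  then show ?thesis using sub by (simp add: direct_sum_def)
qed

lemma poly_component_eq_single:
  assumes "f \<in> poly_component a" "b \<in> Poly_Mapping.keys f"
  shows "f = Poly_Mapping.single b (Poly_Mapping.lookup f b)"
proof (rule poly_mapping_eqI)
  fix c
  show "Poly_Mapping.lookup f c =
    Poly_Mapping.lookup (Poly_Mapping.single b (Poly_Mapping.lookup f b)) c"
  proof (cases "c \<in> Poly_Mapping.keys f")
    case True
    then have "c = b"
      using assms injD[OF inj_exponent_degree] by (auto simp: poly_component_def)
    then show ?thesis by simp
  next
    case False
    then show ?thesis using assms(2) by (auto simp: in_keys_iff lookup_single when_def)
  qed
qed

lemma sum_singles:
  "(\<Sum>b\<in>Poly_Mapping.keys f. Poly_Mapping.single b (Poly_Mapping.lookup f b)) = f"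
  by (rule poly_mapping_eqI) (auto simp: lookup_sum lookup_single when_def in_keys_iff)

lemma finsum_eq_sum:
  fixes M :: "('a::comm_monoid_add, 'b) ring_scheme"
  assumes "abelian_group M" "add M = (+)" "\<zero>\<^bsub>M\<^esub> = 0" "f \<in> B \<rightarrow> carrier M"
  shows "(\<Oplus>\<^bsub>M\<^esub>i\<in>B. f i) = (\<Sum>i\<in>B. f i)"
proof -
  interpret abelian_group M by fact
  show ?thesis using assms(4)
  proof (induction B rule: infinite_finite_induct)
    case (insert i B)
    then show ?case by (simp add: assms(2))
  qed (simp_all add: assms(3) finsum_infinite)
qed

locale multigraded_ideal = ideal I "poly_ring {1..p}"
  for p :: nat and I :: "'k::field mpoly set" +
  assumes single_mem: "\<lbrakk>f \<in> I; b \<in> Poly_Mapping.keys f\<rbrakk>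
    \<Longrightarrow> Poly_Mapping.single b (Poly_Mapping.lookup f b) \<in> I"
begin

lemma I_subset: "I \<subseteq> carrier (poly_ring {1..p})"
  using a_subset .

lemma I_zero: "0 \<in> I"
  using additive_subgroup.zero_closed[OF is_additive_subgroup] by simp

lemma I_add: "f \<in> I \<Longrightarrow> g \<in> I \<Longrightarrow> f + g \<in> I"
  using additive_subgroup.a_closed[OF is_additive_subgroup] by simp

lemma I_mult: "f \<in> carrier (poly_ring {1..p}) \<Longrightarrow> g \<in> I \<Longrightarrow> f * g \<in> I"
  using I_l_closed by simp

lemma I_uminus: "f \<in> I \<Longrightarrow> - f \<in> I"
  using additive_subgroup.a_inv_closed[OF is_additive_subgroup, of f] poly_ring_a_inv[of f "{1..p}"] I_subset by auto

lemma component_mem: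
  assumes "finite B" "\<And>i. i \<in> B \<Longrightarrow> g i \<in> poly_component i" "(\<Sum>i\<in>B. g i) \<in> I" "i \<in> B"
  shows "g i \<in> I"
proof (cases "g i = 0")
  case False
  then obtain b where b: "b \<in> Poly_Mapping.keys (g i)"
    using poly_mapping_eqI[of "g i" 0] by (auto simp: in_keys_iff)
  have *: "exponent_degree b = i"
    using b assms(2)[OF assms(4)] by (simp add: poly_component_def)
  have "Poly_Mapping.lookup (g j) b = 0" if "j \<in> B" "j \<noteq> i" for j
    using assms(2)[OF that(1)] that(2) * by (auto simp: poly_component_def in_keys_iff)
  then have l: "Poly_Mapping.lookup (\<Sum>i\<in>B. g i) b = Poly_Mapping.lookup (g i) b"
    using assms(1,4) by (simp add: lookup_sum sum.remove[of B i "\<lambda>j. Poly_Mapping.lookup (g j) b"])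
  then have "b \<in> Poly_Mapping.keys (\<Sum>i\<in>B. g i)" using b by (simp add: in_keys_iff)
  from single_mem[OF assms(3) this] show ?thesis
    using l poly_component_eq_single[OF assms(2)[OF assms(4)] b] by simp
qed (simp add: I_zero)

lemma ex_component_sum:
  assumes f: "f \<in> carrier (poly_ring {1..p})"
  shows "\<exists>B g. finite B \<and> B \<subseteq> degrees p \<and>
    (\<forall>i\<in>B. g i \<in> poly_component i \<and> (f \<in> I \<longrightarrow> g i \<in> I)) \<and> f = (\<Sum>i\<in>B. g i)"
proof -
  define g where "g = (\<lambda>i. let b = inv_into UNIV exponent_degree i
    in Poly_Mapping.single b (Poly_Mapping.lookup f b))"
  let ?B = "exponent_degree ` Poly_Mapping.keys f"
  have g: "g (exponent_degree b) = Poly_Mapping.single b (Poly_Mapping.lookup f b)" for b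
    by (simp add: g_def Let_def inv_f_f[OF inj_exponent_degree])
  have 1: "(\<Sum>i\<in>?B. g i) = f"
    by (subst sum.reindex) (auto simp: g sum_singles intro: inj_on_subset[OF inj_exponent_degree])
  have 2: "?B \<subseteq> degrees p"
    using f by (auto simp only: carrier_poly_ring exponent_degree_in_degrees)
  have "g i \<in> poly_component i \<and> (f \<in> I \<longrightarrow> g i \<in> I)" if i: "i \<in> ?B" for i
  proof -
    obtain b where b: "i = exponent_degree b" "b \<in> Poly_Mapping.keys f" using i by blast
    show ?thesis using single_mem[OF _ b(2)] by (simp add: b(1) g poly_component_def)
  qed
  with 2 show ?thesis by (intro exI[of _ ?B] exI[of _ g]) (simp add: 1)
qed

lemma abelian_group_ideal_module: "abelian_group (ideal_module (poly_ring {1..p}) I)"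
proof -
  let ?M = "ideal_module (poly_ring {1..p}) I"
  have M: "carrier ?M = I" "add ?M = (+)" "\<zero>\<^bsub>?M\<^esub> = 0"
    by (simp_all add: ideal_module_def)
  have "\<exists>g\<in>I. g + f = 0" if "f \<in> I" for f
    by (rule bexI[of _ "- f"]) (simp, rule I_uminus[OF that])
  then show ?thesis
    by (intro abelian_groupI) (simp_all only: M I_add I_zero add_ac add_0_left add_0_right simp_thms)
qed

lemma ideal_module_multigraded:
  "multigraded_module p (ideal_module (poly_ring {1..p}) I) (ideal_component I)"
proof -
  let ?M = "ideal_module (poly_ring {1..p}) I"
  have M [simp]: "carrier ?M = I" "add ?M = (+)" "\<zero>\<^bsub>?M\<^esub> = 0" "smult ?M = (*)"
    by (simp_all add: ideal_module_def)
  interpret M: abelian_group ?M by (rule abelian_group_ideal_module)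
  have inv: "\<ominus>\<^bsub>?M\<^esub> f = - f" if "f \<in> I" for f
    using M.minus_equality[of "- f" f] that I_uminus[OF that] by simp
  have mod: "module (poly_ring {1..p}) ?M"
    by (rule moduleI[OF cring_poly_ring M.abelian_group_axioms])
       (auto simp: I_mult algebra_simps)
  have "direct_sum ?M (degrees p) (ideal_component I)"
  proof (rule direct_sumI[OF M.abelian_group_axioms])
    fix a
    show "additive_subgroup (ideal_component I a) ?M"
    proof (rule additive_subgroup.intro, rule M.add.subgroupI)
      show "ideal_component I a \<noteq> {}"
        using I_zero by (auto simp: ideal_component_def poly_component_def)
      fix f g assume f: "f \<in> ideal_component I a"
      then show "\<ominus>\<^bsub>?M\<^esub> f \<in> ideal_component I a"
        using I_uminus by (auto simp: ideal_component_def poly_component_def inv in_keys_iff)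
      assume g: "g \<in> ideal_component I a"
      then show "f \<oplus>\<^bsub>?M\<^esub> g \<in> ideal_component I a"
        using f I_add keys_add[of f g] by (auto simp: ideal_component_def poly_component_def)
    qed (auto simp: ideal_component_def)
  next
    fix f assume "f \<in> carrier ?M"
    then have f: "f \<in> I" by simp
    obtain B g where g: "finite B" "B \<subseteq> degrees p"
        "\<forall>i\<in>B. g i \<in> poly_component i \<and> (f \<in> I \<longrightarrow> g i \<in> I)" "f = (\<Sum>i\<in>B. g i)"
      using ex_component_sum[OF subsetD[OF I_subset f]] by blast
    have gI: "g i \<in> I" if "i \<in> B" for i using g(3) f that by simp
    have "f = (\<Oplus>\<^bsub>?M\<^esub>i\<in>B. g i)"
      using g(4) gI finsum_eq_sum[OF M.abelian_group_axioms, of g B] by auto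
    then show "\<exists>B g. finite B \<and> B \<subseteq> degrees p \<and> (\<forall>i\<in>B. g i \<in> ideal_component I i) \<and>
        f = (\<Oplus>\<^bsub>?M\<^esub>i\<in>B. g i)"
      using g(1-3) gI by (intro exI[of _ B] exI[of _ g]) (auto simp: ideal_component_def)
  next
    fix B :: "(nat \<Rightarrow> int) set" and g
    assume B: "finite B" "B \<subseteq> degrees p" "\<And>i. i \<in> B \<Longrightarrow> g i \<in> ideal_component I i"
      and z: "(\<Oplus>\<^bsub>?M\<^esub>i\<in>B. g i) = \<zero>\<^bsub>?M\<^esub>"
    have sum: "(\<Sum>i\<in>B. g i) = 0"
      using z B finsum_eq_sum[OF M.abelian_group_axioms, of g B] by (auto simp: ideal_component_def)
    interpret Z: multigraded_ideal p "{0} :: 'k mpoly set"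
      using zeroideal by (auto intro!: multigraded_ideal.intro multigraded_ideal_axioms.intro)
    show "\<forall>i\<in>B. g i = \<zero>\<^bsub>?M\<^esub>"
      using Z.component_mem[OF B(1), of g] B(3) sum by (auto simp: ideal_component_def)
  qed
  with mod show ?thesis
    by (intro multigraded_module.intro multigraded_module_axioms.intro)
       (auto simp: ideal_component_def poly_component_mult I_mult
             dest: subsetD[OF poly_component_subset])
qed

lemma quotient_module_multigraded:
  "multigraded_module p (quotient_module (poly_ring {1..p}) I) (quotient_component p I)"
proof -
  let ?S = "poly_ring {1..p} :: 'k mpoly ring"
  let ?M = "quotient_module ?S I"
  let ?c = "\<lambda>f. I +>\<^bsub>?S\<^esub> f"
  have M: "carrier ?M = ?c ` carrier ?S" "\<zero>\<^bsub>?M\<^esub> = I"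
    by (auto simp: quotient_module_def FactRing_def A_RCOSETS_def' a_r_coset_def')
  have add: "?c f \<oplus>\<^bsub>?M\<^esub> ?c g = ?c (f + g)" if "f \<in> carrier ?S" "g \<in> carrier ?S" for f g
    using a_rcos_sum[OF that] by (simp add: quotient_module_def FactRing_def)
  have smult: "f \<odot>\<^bsub>?M\<^esub> ?c g = ?c (f * g)" if "f \<in> carrier ?S" "g \<in> carrier ?S" for f g
    using rcoset_mult_add[OF that] by (simp add: quotient_module_def FactRing_def)
  have zero: "?c f = I \<longleftrightarrow> f \<in> I" if "f \<in> carrier ?S" for f
    using a_rcos_const a_rcos_self[OF that] by blast
  interpret Q: ring "?S Quot I" by (rule quotient_is_ring)
  have Q: "carrier ?M = carrier (?S Quot I)" "add ?M = add (?S Quot I)"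
    "\<zero>\<^bsub>?M\<^esub> = \<zero>\<^bsub>?S Quot I\<^esub>"
    by (simp_all add: quotient_module_def)
  have ag: "abelian_group ?M"
    by (rule abelian_groupI) (simp_all add: Q Q.a_ac Q.add.l_inv_ex)
  interpret M: abelian_group ?M by (rule ag)
  have inv: "\<ominus>\<^bsub>?M\<^esub> ?c f = ?c (- f)" if "f \<in> carrier ?S" for f
    using M.minus_equality[of "?c (- f)" "?c f"] that poly_ring_uminus_closed[OF that]
      zero[of 0] I_zero I_subset
    by (auto simp: M add)
  have mod: "module ?S ?M"
    by (rule moduleI[OF cring_poly_ring ag])
       (auto simp: M add smult algebra_simps poly_ring_01_closed poly_ring_add_closed poly_ring_mult_closed)
  have fs: "(\<Oplus>\<^bsub>?M\<^esub>i\<in>B. ?c (g i)) = ?c (\<Sum>i\<in>B. g i) \<and> (\<Sum>i\<in>B. g i) \<in> carrier ?S"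
    if "finite B" "\<And>i. i \<in> B \<Longrightarrow> g i \<in> carrier ?S" for B :: "(nat \<Rightarrow> int) set" and g
    using that
  proof (induction B rule: finite_induct)
    case empty
    then show ?case using zero[of 0] I_zero I_subset by (auto simp: M)
  next
    case (insert i B)
    then have "(\<lambda>i. ?c (g i)) \<in> B \<rightarrow> carrier ?M" "?c (g i) \<in> carrier ?M" by (auto simp: M)
    then show ?case using insert by (simp add: add poly_ring_add_closed)
  qed
  have "direct_sum ?M (degrees p) (quotient_component p I)"
  proof (rule direct_sumI[OF ag])
    fix a :: "nat \<Rightarrow> int" assume a: "a \<in> degrees p"
    have c: "f \<in> carrier ?S" if "f \<in> poly_component a" for f
      using poly_component_subset[OF a] that by blast
    show "additive_subgroup (quotient_component p I a) ?M"
    proof (rule additive_subgroup.intro, rule M.add.subgroupI)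
      show "quotient_component p I a \<subseteq> carrier ?M"
        using c by (auto simp: quotient_component_def M)
      show "quotient_component p I a \<noteq> {}"
        by (auto simp: quotient_component_def poly_component_def intro!: exI[of _ 0])
      fix x y assume x: "x \<in> quotient_component p I a"
      then obtain f where f: "x = ?c f" "f \<in> poly_component a"
        by (auto simp: quotient_component_def)
      have "- f \<in> poly_component a" using f(2) by (simp add: poly_component_def in_keys_iff)
      then show "\<ominus>\<^bsub>?M\<^esub> x \<in> quotient_component p I a"
        using f c by (auto simp: quotient_component_def inv)
      assume y: "y \<in> quotient_component p I a"
      then obtain g where g: "y = ?c g" "g \<in> poly_component a"
        by (auto simp: quotient_component_def)
      have "f + g \<in> poly_component a"
        using f(2) g(2) keys_add[of f g] by (auto simp: poly_component_def)
      then show "x \<oplus>\<^bsub>?M\<^esub> y \<in> quotient_component p I a"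
        using f g c by (auto simp: quotient_component_def add)
    qed
  next
    fix x assume "x \<in> carrier ?M"
    then obtain f where f: "x = ?c f" "f \<in> carrier ?S" by (auto simp: M)
    obtain B g where g: "finite B" "B \<subseteq> degrees p"
        "\<forall>i\<in>B. g i \<in> poly_component i \<and> (f \<in> I \<longrightarrow> g i \<in> I)" "f = (\<Sum>i\<in>B. g i)"
      using ex_component_sum[OF f(2)] by blast
    have "g i \<in> carrier ?S" if "i \<in> B" for i
      using subsetD[OF poly_component_subset] g(2,3) that by (meson subsetD)
    then have "x = (\<Oplus>\<^bsub>?M\<^esub>i\<in>B. ?c (g i))" using fs[OF g(1)] f g(4) by simp
    then show "\<exists>B h. finite B \<and> B \<subseteq> degrees p \<and> (\<forall>i\<in>B. h i \<in> quotient_component p I i) \<and>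
        x = (\<Oplus>\<^bsub>?M\<^esub>i\<in>B. h i)"
      using g by (intro exI[of _ B] exI[of _ "\<lambda>i. ?c (g i)"]) (auto simp: quotient_component_def)
  next
    fix B :: "(nat \<Rightarrow> int) set" and h
    assume B: "finite B" "B \<subseteq> degrees p" "\<And>i. i \<in> B \<Longrightarrow> h i \<in> quotient_component p I i"
      and z: "(\<Oplus>\<^bsub>?M\<^esub>i\<in>B. h i) = \<zero>\<^bsub>?M\<^esub>"
    have "\<forall>i\<in>B. \<exists>f. f \<in> poly_component i \<and> h i = ?c f"
      using B(3) by (auto simp: quotient_component_def)
    then obtain g where "\<forall>i\<in>B. g i \<in> poly_component i \<and> h i = ?c (g i)"
      using bchoice by meson
    then have g: "g i \<in> poly_component i" "h i = ?c (g i)" if "i \<in> B" for i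
      using that by simp_all
    have gc: "g i \<in> carrier ?S" if "i \<in> B" for i
      using subsetD[OF poly_component_subset] g(1) B(2) that by (meson subsetD)
    have "(\<Oplus>\<^bsub>?M\<^esub>i\<in>B. h i) = (\<Oplus>\<^bsub>?M\<^esub>i\<in>B. ?c (g i))"
      by (rule M.finsum_cong') (use g gc in \<open>auto simp: M\<close>)
    with z have "?c (\<Sum>i\<in>B. g i) = I" using fs[OF B(1) gc] by (simp add: M(2))
    then have "(\<Sum>i\<in>B. g i) \<in> I" using zero[of "\<Sum>i\<in>B. g i"] fs[OF B(1) gc] by simp
    then have "g i \<in> I" if "i \<in> B" for i
      using component_mem[OF B(1) g(1)] that by simp
    then show "\<forall>i\<in>B. h i = \<zero>\<^bsub>?M\<^esub>" using g(2) gc zero by (simp add: M)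
  qed
  moreover have "f \<odot>\<^bsub>?M\<^esub> x \<in> quotient_component p I (\<lambda>i. a i + b i)"
    if prem: "a \<in> degrees p" "b \<in> degrees p" "f \<in> poly_component a" "x \<in> quotient_component p I b"
    for a b f x
  proof -
    obtain g where g: "x = ?c g" "g \<in> poly_component b"
      using prem(4) by (auto simp: quotient_component_def)
    have "f \<odot>\<^bsub>?M\<^esub> x = ?c (f * g)"
      using smult[OF subsetD[OF poly_component_subset[OF prem(1)] prem(3)]
          subsetD[OF poly_component_subset[OF prem(2)] g(2)]] by (simp add: g(1))
    then show ?thesis
      using poly_component_mult[OF prem(3) g(2)] by (auto simp: quotient_component_def)
  qed
  ultimately show ?thesis
    using mod by (intro multigraded_module.intro multigraded_module_axioms.intro) auto
qed

end

lemma multigraded_ideal_Int: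
  assumes "multigraded_ideal p I" "multigraded_ideal p J"
  shows "multigraded_ideal p (I \<inter> J)"
proof -
  interpret I: multigraded_ideal p I by fact
  interpret J: multigraded_ideal p J by fact
  show ?thesis
    using I.single_mem J.single_mem
    by (intro multigraded_ideal.intro multigraded_ideal_axioms.intro
        I.i_intersect[OF I.ideal_axioms J.ideal_axioms]) auto
qed

lemma genideal_vars:
  assumes A: "A \<subseteq> {1..p}"
  shows "genideal (poly_ring {1..p}) (var ` A :: 'k::field mpoly set) =
    {f \<in> carrier (poly_ring {1..p}). \<forall>b\<in>Poly_Mapping.keys f. Poly_Mapping.keys b \<inter> A \<noteq> {}}"
    (is "?G = ?J")
proof
  let ?S = "poly_ring {1..p} :: 'k mpoly ring"
  interpret cring ?S by (rule cring_poly_ring)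
  have vars: "var ` A \<subseteq> carrier ?S"
    using A by (auto simp: var_def carrier_poly_ring)
  have "ideal ?J ?S"
  proof (rule idealI[OF ring_axioms])
    show "subgroup ?J (add_monoid ?S)"
    proof (rule add.subgroupI)
      show "?J \<noteq> {}" by (auto simp: carrier_poly_ring intro!: exI[of _ 0])
      fix f g assume f: "f \<in> ?J"
      then show "\<ominus>\<^bsub>?S\<^esub> f \<in> ?J"
        using poly_ring_uminus_closed[of f "{1..p}"] by (auto simp: poly_ring_a_inv in_keys_iff)
      assume "g \<in> ?J"
      then show "f \<oplus>\<^bsub>?S\<^esub> g \<in> ?J"
        using f poly_ring_add_closed[of f "{1..p}" g] subsetD[OF keys_add[of f g]] by auto
    qed auto
    have mult: "g * f \<in> ?J" if f: "f \<in> ?J" and g: "g \<in> carrier ?S" for f g :: "'k mpoly"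
    proof -
      have "Poly_Mapping.keys b \<inter> A \<noteq> {}" if b: "b \<in> Poly_Mapping.keys (g * f)" for b
      proof -
        obtain c d where cd: "b = c + d" "d \<in> Poly_Mapping.keys f"
          using b keys_mult[of g f] by blast
        moreover have "Poly_Mapping.keys d \<subseteq> Poly_Mapping.keys (c + d)"
          by (auto simp: in_keys_iff lookup_add)
        moreover have "Poly_Mapping.keys d \<inter> A \<noteq> {}" using f cd(2) by simp
        ultimately show ?thesis by auto
      qed
      then show ?thesis using f g poly_ring_mult_closed by auto
    qed
    fix f g assume "f \<in> ?J" "g \<in> carrier ?S"
    then show "g \<otimes>\<^bsub>?S\<^esub> f \<in> ?J" "f \<otimes>\<^bsub>?S\<^esub> g \<in> ?J"
      using mult[of f g] by (simp_all add: mult.commute)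
  qed
  moreover have "var ` A \<subseteq> ?J"
    using vars by (auto simp: var_def)
  ultimately show "?G \<subseteq> ?J" by (rule genideal_minimal)
  interpret G: ideal ?G ?S by (rule genideal_ideal[OF vars])
  show "?J \<subseteq> ?G"
  proof
    fix f assume f: "f \<in> ?J"
    have "Poly_Mapping.single b (Poly_Mapping.lookup f b) \<in> ?G" if b: "b \<in> Poly_Mapping.keys f" for b
    proof -
      obtain i where i: "i \<in> Poly_Mapping.keys b" "i \<in> A" using f b by blast
      let ?c = "b - Poly_Mapping.single i 1"
      have bc: "b = ?c + Poly_Mapping.single i 1"
        using i(1) by (intro poly_mapping_eqI)
          (auto simp: lookup_add lookup_minus lookup_single when_def in_keys_iff)
      have "Poly_Mapping.keys b \<subseteq> {1..p}"
        using f b by (simp add: carrier_poly_ring)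
      moreover have "Poly_Mapping.keys ?c \<subseteq> Poly_Mapping.keys b"
        by (auto simp: in_keys_iff lookup_minus)
      ultimately have "Poly_Mapping.keys ?c \<subseteq> {1..p}" by (rule order_trans[rotated])
      then have "Poly_Mapping.single ?c (Poly_Mapping.lookup f b) \<in> carrier ?S"
        by (simp add: carrier_poly_ring)
      moreover have "var i \<in> ?G" using genideal_self[OF vars] i(2) by blast
      ultimately have "Poly_Mapping.single ?c (Poly_Mapping.lookup f b) * var i \<in> ?G"
        using G.I_l_closed by simp
      moreover have "Poly_Mapping.single ?c (Poly_Mapping.lookup f b) * var i =
          Poly_Mapping.single b (Poly_Mapping.lookup f b)"
        unfolding var_def by (subst mult_single) (use bc in simp)
      ultimately show ?thesis by simp
    qed
    moreover have "(\<Sum>b\<in>B. h b) \<in> ?G" if "finite B" "\<And>b. b \<in> B \<Longrightarrow> h b \<in> ?G"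
      for B :: "(nat \<Rightarrow>\<^sub>0 nat) set" and h
      using that
    proof (induction B rule: finite_induct)
      case empty
      then show ?case using G.zero_closed by simp
    next
      case (insert b B)
      then show ?case using G.a_closed[of "h b" "\<Sum>b\<in>B. h b"] by simp
    qed
    ultimately have "(\<Sum>b\<in>Poly_Mapping.keys f. Poly_Mapping.single b (Poly_Mapping.lookup f b)) \<in> ?G"
      by simp
    then show "f \<in> ?G" by (simp only: sum_singles)
  qed
qed

lemma multigraded_ideal_genideal_vars:
  assumes "A \<subseteq> {1..p}"
  shows "multigraded_ideal p (genideal (poly_ring {1..p}) (var ` A :: 'k::field mpoly set))"
proof -
  interpret cring "poly_ring {1..p} :: 'k mpoly ring" by (rule cring_poly_ring)
  have "var ` A \<subseteq> carrier (poly_ring {1..p} :: 'k mpoly ring)"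
    using assms by (auto simp: var_def carrier_poly_ring)
  from genideal_ideal[OF this] show ?thesis
    by (intro multigraded_ideal.intro multigraded_ideal_axioms.intro)
       (auto simp: genideal_vars[OF assms] carrier_poly_ring split: if_splits)
qed

declare One_nat_def [simp]

end

theory Submission
  imports Defs
begin

text \<open>Both modules have one-dimensional nonzero components, so a Stanley decomposition is a partition
  of the set of their monomials into cones \<open>b + \<nat>\<^sup>Z\<close>. As membership of a monomial depends only
  on its support, interval partitions of the families of supports give decompositions, the interval
  \<open>[A, B]\<close> yielding the cone with squarefree vertex of support \<open>A\<close> and \<open>Z = B\<close>. For the
  lower bounds it suffices to partition the nonempty subsets of an \<open>n\<close>-set into intervals with \<open>2|B| \<ge> n\<close>. On a cycle of odd
  length \<open>n\<close>, a nonempty subset, read as a cyclic binary word, has exactly one factorization over the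
  prefix code \<open>1, 00, 01\<close>, since every \<open>1\<close> ends a code word. The words with a given cutting pattern
  form an interval whose top omits only the first point of each two-letter word. For even \<open>n\<close>, drop
  a point from the cycle of length \<open>n + 1\<close>.

  A cone of \<open>S/I\<close> that contains some \<open>y\<^sub>j\<close> involves only the variables \<open>y\<close>, whence \<open>sdepth(S/I) \<le> m\<close>.
  In \<open>I\<close> consider the cones that contain the monomials \<open>x\<^sub>i y\<^sub>1\<close>. Disjointness prevents both \<open>x\<^sub>j\<close> from
  being a direction of the cone at \<open>x\<^sub>i y\<^sub>1\<close> and \<open>x\<^sub>i\<close> from being one of the cone at \<open>x\<^sub>j y\<^sub>1\<close> if \<open>i \<noteq> j\<close>,
  so that together these \<open>n\<close> cones have at most \<open>n (n + 1) / 2\<close> directions \<open>x\<^sub>j\<close>.\<close>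

section \<open>Interval partitions\<close>

text \<open>The condition \<open>A \<subseteq> B\<close> makes every interval nonempty, so both of
  its ends belong to \<open>\<S>\<close>; properties of the ends are read off from this
  later.\<close>

definition interval_partition :: "'a set set \<Rightarrow> ('a set \<times> 'a set) set \<Rightarrow> bool" where
  "interval_partition \<S> G \<longleftrightarrow> finite G \<and> (\<forall>(A, B)\<in>G. A \<subseteq> B \<and> {A..B} \<subseteq> \<S>) \<and>
     (\<forall>T\<in>\<S>. \<exists>!I. I \<in> G \<and> T \<in> {fst I..snd I})"

lemma interval_partitionD:
  assumes "interval_partition \<S> G"
  shows "finite G"
    and "(A, B) \<in> G \<Longrightarrow> A \<subseteq> B"
    and "(A, B) \<in> G \<Longrightarrow> A \<subseteq> T \<Longrightarrow> T \<subseteq> B \<Longrightarrow> T \<in> \<S>"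
    and "T \<in> \<S> \<Longrightarrow> \<exists>!I. I \<in> G \<and> T \<in> {fst I..snd I}"
proof -
  show "finite G" using assms by (simp add: interval_partition_def)
  show "A \<subseteq> B" if "(A, B) \<in> G"
    using assms that by (auto simp: interval_partition_def)
  show "T \<in> \<S>" if "(A, B) \<in> G" "A \<subseteq> T" "T \<subseteq> B"
  proof -
    have "{A..B} \<subseteq> \<S>" using assms that(1) by (auto simp: interval_partition_def)
    then show ?thesis using that(2,3) by auto
  qed
  show "\<exists>!I. I \<in> G \<and> T \<in> {fst I..snd I}" if "T \<in> \<S>"
    using assms that by (simp add: interval_partition_def)
qed

text \<open>The positions \<open>i \<in> M\<close> are the second letters of the words \<open>00\<close> and \<open>01\<close>.\<close>

lemma cyclic_recursion:
  assumes "T \<subseteq> {..<N}" and "T \<noteq> {}"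
  shows "\<exists>!M. M \<subseteq> {..<N} \<and> (\<forall>i<N. Suc i mod N \<in> M \<longleftrightarrow> i \<notin> M \<and> i \<notin> T)"
proof -
  from assms obtain t where t: "t \<in> T" "t < N" by auto
  \<comment> \<open>The cyclic recursion is unrolled along the natural numbers with the arbitrary
    start value \<open>False\<close>. Directly after a point of \<open>T\<close> the value is
    \<open>False\<close> whatever came before, so from \<open>Suc t\<close> on the start no longer
    matters.\<close>
  define s where "s = rec_nat False (\<lambda>j b. \<not> b \<and> j mod N \<notin> T)"
  have s: "s (Suc j) \<longleftrightarrow> \<not> s j \<and> j mod N \<notin> T" for j
    by (simp add: s_def)
  have periodic: "s (j + N) = s j" if "j \<ge> Suc t" for j
    using that
  proof (induction j rule: dec_induct)
    case base
    then show ?case using t by (simp add: s)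
  next
    case (step j)
    then show ?case by (simp add: s)
  qed
  show ?thesis
  proof (rule ex1I)
    \<comment> \<open>The solution is read off during the second turn:
      \<open>i + N \<ge> Suc t\<close> for every \<open>i\<close>, since
      \<open>t < N\<close>.\<close>
    let ?M = "{i. i < N \<and> s (i + N)}"
    show "?M \<subseteq> {..<N} \<and> (\<forall>i<N. Suc i mod N \<in> ?M \<longleftrightarrow> i \<notin> ?M \<and> i \<notin> T)"
    proof (intro conjI allI impI)
      fix i assume i: "i < N"
      \<comment> \<open>Only the step across the end of the cycle needs periodicity; it compares
        \<open>s N\<close> with \<open>s (N + N)\<close>.\<close>
      have "s (Suc i mod N + N) = s (Suc i + N)"
      proof (cases "Suc i = N")
        case True
        then show ?thesis using periodic[of N] t by simp
      next
        case False
        then show ?thesis using i by simp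
      qed
      also have "\<dots> \<longleftrightarrow> \<not> s (i + N) \<and> i \<notin> T"
        using i by (simp add: s)
      finally show "Suc i mod N \<in> ?M \<longleftrightarrow> i \<notin> ?M \<and> i \<notin> T"
        using i by simp
    qed auto
  next
    fix M assume M: "M \<subseteq> {..<N} \<and> (\<forall>i<N. Suc i mod N \<in> M \<longleftrightarrow> i \<notin> M \<and> i \<notin> T)"
    \<comment> \<open>Every solution also forgets its past at \<open>t\<close>, so the same
      induction identifies it with \<open>s\<close>.\<close>
    have eq: "j mod N \<in> M \<longleftrightarrow> s j" if "j \<ge> Suc t" for j
      using that
    proof (induction j rule: dec_induct)
      case base
      then show ?case using M t s by simp
    next
      case (step j)
      have "Suc j mod N = Suc (j mod N) mod N" by (simp add: mod_Suc_eq)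
      moreover have "j mod N < N" using t by simp
      ultimately show ?case using M step by (simp add: s)
    qed
    have "i \<in> M \<longleftrightarrow> i < N \<and> s (i + N)" for i
      using eq[of "i + N"] M t by (cases "i < N") auto
    then show "M = {i. i < N \<and> s (i + N)}" by blast
  qed
qed

lemma bij_betw_Suc_mod: "bij_betw (\<lambda>i. Suc i mod N) {..<N} {..<N}"
proof -
  have "inj_on (\<lambda>i. Suc i mod N) {..<N}"
    by (rule inj_onI) (auto simp: mod_Suc split: if_splits)
  moreover have "(\<lambda>i. Suc i mod N) ` {..<N} \<subseteq> {..<N}"
    by (auto intro: mod_less_divisor)
  ultimately show ?thesis
    by (simp add: bij_betw_def endo_inj_surj)
qed

text \<open>Cutting the cycle into dominoes \<open>{i, i + 1}\<close> with \<open>i + 1 \<in> M\<close> and single points, the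
  interval of \<open>M\<close> consists of the sets that contain all single points and, of each domino, at
  most the second point.\<close>

lemma interval_partition_odd_cycle:
  assumes "odd N"
  shows "\<exists>G. interval_partition {T. T \<subseteq> {..<N} \<and> T \<noteq> {}} G \<and> (\<forall>(A, B)\<in>G. N < 2 * card B)"
proof -
  \<comment> \<open>These are the first points of the dominoes. Disjointness from \<open>M\<close>,
    demanded in \<open>\<M>\<close>, says that no point lies in two dominoes.\<close>
  define next_in where "next_in M = {i. i < N \<and> Suc i mod N \<in> M}" for M
  define \<M> where "\<M> = {M. M \<subseteq> {..<N} \<and> M \<inter> next_in M = {}}"
  define lo where "lo M = {..<N} - next_in M - M" for M
  define hi where "hi M = {..<N} - next_in M" for M
  let ?G = "(\<lambda>M. (lo M, hi M)) ` \<M>"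
  \<comment> \<open>Lying in the interval of \<open>M\<close> is the same as solving the recursion
    for \<open>T\<close>, so \<open>cyclic_recursion\<close> yields exactly one interval for each
    nonempty \<open>T\<close>.\<close>
  have mem: "T \<in> {lo M..hi M} \<longleftrightarrow> (\<forall>i<N. Suc i mod N \<in> M \<longleftrightarrow> i \<notin> M \<and> i \<notin> T)"
    if "M \<in> \<M>" "T \<subseteq> {..<N}" for M T
  proof -
    have "\<And>i. i < N \<Longrightarrow> i \<in> M \<Longrightarrow> Suc i mod N \<notin> M"
      using that(1) by (auto simp: \<M>_def next_in_def)
    moreover have "T \<in> {lo M..hi M} \<longleftrightarrow>
        (\<forall>i<N. (Suc i mod N \<notin> M \<and> i \<notin> M \<longrightarrow> i \<in> T) \<and> (i \<in> T \<longrightarrow> Suc i mod N \<notin> M))"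
      using that(2) unfolding lo_def hi_def next_in_def by (simp add: subset_iff) blast
    ultimately show ?thesis by blast
  qed
  have card_next: "card (next_in M) = card M" "finite (next_in M)" if "M \<subseteq> {..<N}" for M
  proof -
    have "(\<lambda>i. Suc i mod N) ` next_in M = M"
    proof
      show "M \<subseteq> (\<lambda>i. Suc i mod N) ` next_in M"
      proof
        fix j assume "j \<in> M"
        then have "j \<in> (\<lambda>i. Suc i mod N) ` {..<N}"
          using that bij_betw_imp_surj_on[OF bij_betw_Suc_mod[of N]] by blast
        with \<open>j \<in> M\<close> show "j \<in> (\<lambda>i. Suc i mod N) ` next_in M"
          unfolding next_in_def by blast
      qed
    qed (auto simp: next_in_def)
    then have "bij_betw (\<lambda>i. Suc i mod N) (next_in M) M"
      by (rule bij_betw_subset[OF bij_betw_Suc_mod, rotated]) (auto simp: next_in_def)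
    then show "card (next_in M) = card M" by (rule bij_betw_same_card)
    show "finite (next_in M)" by (simp add: next_in_def)
  qed
  have card_hi: "N < 2 * card (hi M)" "lo M \<noteq> {}" if "M \<in> \<M>" for M
  proof -
    have M: "M \<subseteq> {..<N}" "M \<inter> next_in M = {}" "next_in M \<subseteq> {..<N}" "finite M"
      using that by (auto simp: \<M>_def next_in_def finite_subset)
    have "card (M \<union> next_in M) = card M + card M"
      using card_next[OF M(1)] M by (simp add: card_Un_disjoint)
    moreover have "card (M \<union> next_in M) \<le> N"
      using card_mono[of "{..<N}" "M \<union> next_in M"] M by simp
    \<comment> \<open>The dominoes cover an even number of points, so on an odd cycle at least one
      single point remains.\<close>
    ultimately have "2 * card M < N" using assms by (cases "2 * card M = N") auto
    moreover have "card (hi M) = N - card M"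
      using card_Diff_subset[of "next_in M" "{..<N}"] card_next[OF M(1)] M by (simp add: hi_def)
    ultimately show "N < 2 * card (hi M)" by linarith
    \<comment> \<open>Without single points every upper point would be a second point, but
      \<open>M\<close> has fewer than half of all points and \<open>hi M\<close> more than
      half.\<close>
    moreover have "hi M \<subseteq> M" if "lo M = {}" using that by (auto simp: lo_def hi_def)
    ultimately show "lo M \<noteq> {}"
      using card_mono[of M "hi M"] M(4) \<open>2 * card M < N\<close> by force
  qed
  have "interval_partition {T. T \<subseteq> {..<N} \<and> T \<noteq> {}} ?G"
    unfolding interval_partition_def
  proof (intro conjI ballI)
    show "finite ?G" by (simp add: \<M>_def)
  next
    fix I assume "I \<in> ?G"
    then show "case I of (A, B) \<Rightarrow> A \<subseteq> B \<and> {A..B} \<subseteq> {T. T \<subseteq> {..<N} \<and> T \<noteq> {}}"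
      using card_hi by (auto simp: lo_def hi_def)
  next
    fix T assume "T \<in> {T. T \<subseteq> {..<N} \<and> T \<noteq> {}}"
    then have T: "T \<subseteq> {..<N}" "T \<noteq> {}" by auto
    obtain M where M: "M \<subseteq> {..<N} \<and> (\<forall>i<N. Suc i mod N \<in> M \<longleftrightarrow> i \<notin> M \<and> i \<notin> T)"
      and unique: "\<forall>M'. M' \<subseteq> {..<N} \<and> (\<forall>i<N. Suc i mod N \<in> M' \<longleftrightarrow> i \<notin> M' \<and> i \<notin> T) \<longrightarrow> M' = M"
      using cyclic_recursion[OF T] by (rule ex1E)
    have "M \<in> \<M>" using M by (auto simp: \<M>_def next_in_def)
    show "\<exists>!I. I \<in> ?G \<and> T \<in> {fst I..snd I}"
    proof (rule ex1I[of _ "(lo M, hi M)"])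
      show "(lo M, hi M) \<in> ?G \<and> T \<in> {fst (lo M, hi M)..snd (lo M, hi M)}"
        using mem[OF \<open>M \<in> \<M>\<close> T(1)] M \<open>M \<in> \<M>\<close> by auto
      fix I assume "I \<in> ?G \<and> T \<in> {fst I..snd I}"
      then obtain M' where M': "M' \<in> \<M>" "I = (lo M', hi M')" "T \<in> {lo M'..hi M'}" by auto
      from M'(1) have "M' \<subseteq> {..<N}" by (simp add: \<M>_def)
      then have "M' = M" using unique M'(3) unfolding mem[OF M'(1) T(1)] by blast
      with M' show "I = (lo M, hi M)" by simp
    qed
  qed
  then show ?thesis using card_hi by blast
qed

text \<open>For even \<open>card V\<close>, the set \<open>V\<close> is placed on a cycle with one
  additional point, and the partition of the cycle is restricted to the sets that avoid this
  point.\<close>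

lemma interval_partition_nonempty_subsets:
  assumes "finite V"
  shows "\<exists>G. interval_partition {T. T \<subseteq> V \<and> T \<noteq> {}} G \<and> (\<forall>(A, B)\<in>G. card V \<le> 2 * card B)"
proof -
  define N where "N = (if odd (card V) then card V else Suc (card V))"
  obtain f where f: "bij_betw f V {..<card V}"
    using ex_bij_betw_finite_nat[OF assms] by (auto simp: atLeast0LessThan)
  have inj: "inj_on f V" and im: "f ` V = {..<card V}"
    using f by (auto simp: bij_betw_def)
  have "odd N" by (simp add: N_def)
  then obtain G where G: "interval_partition {T. T \<subseteq> {..<N} \<and> T \<noteq> {}} G"
      "\<And>A B. (A, B) \<in> G \<Longrightarrow> N < 2 * card B"
    using interval_partition_odd_cycle by blast
  note G' = interval_partitionD[OF G(1)]
  define r where "r A = V \<inter> f -` A" for A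
  \<comment> \<open>An interval whose lower end contains the additional point holds no image of a
    subset of \<open>V\<close> and is dropped. The other upper ends merely lose that point.\<close>
  let ?G = "(\<lambda>(A, B). (r A, r B)) ` {(A, B) \<in> G. A \<subseteq> {..<card V}}"
  have r_sub: "r A \<subseteq> V" for A by (simp add: r_def)
  have r: "f ` r A = A \<inter> {..<card V}" for A
    using im by (auto 0 4 simp: r_def simp del: lessThan_iff)
  have mem: "T \<in> {r A..r B} \<longleftrightarrow> f ` T \<in> {A..B}" if "A \<subseteq> {..<card V}" "T \<subseteq> V" for A B T
  proof -
    have "r A \<subseteq> T \<longleftrightarrow> f ` r A \<subseteq> f ` T"
      using inj that by (blast dest: inj_onD intro: subsetD[OF r_sub])
    moreover have "A \<inter> {..<card V} = A" using that by auto
    ultimately have "r A \<subseteq> T \<longleftrightarrow> A \<subseteq> f ` T" by (simp only: r)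
    then show ?thesis using that by (auto simp: r_def)
  qed
  have "interval_partition {T. T \<subseteq> V \<and> T \<noteq> {}} ?G"
    unfolding interval_partition_def
  proof (intro conjI ballI)
    show "finite ?G" by (intro finite_imageI finite_subset[OF _ G'(1)]) auto
  next
    fix I assume "I \<in> ?G"
    then obtain A B where I: "I = (r A, r B)" "(A, B) \<in> G" "A \<subseteq> {..<card V}" by auto
    have "A \<noteq> {}" using G'(2)[OF I(2)] G'(3)[OF I(2), of A] by simp
    then have "r A \<noteq> {}" using r[of A] I(3) by auto
    moreover have "r A \<subseteq> r B" using G'(2)[OF I(2)] by (auto simp: r_def)
    moreover have "r B \<subseteq> V" by (simp add: r_def)
    ultimately have "T \<subseteq> V \<and> T \<noteq> {}" if "T \<in> {r A..r B}" for T
      using that by auto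
    then show "case I of (A, B) \<Rightarrow> A \<subseteq> B \<and> {A..B} \<subseteq> {T. T \<subseteq> V \<and> T \<noteq> {}}"
      using \<open>r A \<subseteq> r B\<close> unfolding I(1) prod.case by blast
  next
    fix T assume "T \<in> {T. T \<subseteq> V \<and> T \<noteq> {}}"
    then have T: "T \<subseteq> V" "f ` T \<subseteq> {..<card V}" "f ` T \<noteq> {}" using im by auto
    have "{..<card V} \<subseteq> {..<N}" by (auto simp: N_def)
    with T have "\<exists>!I. I \<in> G \<and> f ` T \<in> {fst I..snd I}" by (intro G'(4)) auto
    then obtain I where I: "I \<in> G" "f ` T \<in> {fst I..snd I}"
        "\<forall>I'. I' \<in> G \<and> f ` T \<in> {fst I'..snd I'} \<longrightarrow> I' = I"
      by (elim ex1E conjE)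
    obtain A B where AB: "I = (A, B)" by (cases I)
    have A: "A \<subseteq> {..<card V}" using I(2) subset_trans[OF _ T(2)] by (simp add: AB)
    show "\<exists>!I. I \<in> ?G \<and> T \<in> {fst I..snd I}"
    proof (rule ex1I[of _ "(r A, r B)"])
      show "(r A, r B) \<in> ?G \<and> T \<in> {fst (r A, r B)..snd (r A, r B)}"
        using mem[OF A T(1)] I(1,2) A by (auto simp: AB)
      fix I' assume "I' \<in> ?G \<and> T \<in> {fst I'..snd I'}"
      then obtain A' B' where I': "I' = (r A', r B')" "(A', B') \<in> G" "A' \<subseteq> {..<card V}"
          "T \<in> {r A'..r B'}" by auto
      then have "f ` T \<in> {A'..B'}" using mem[OF I'(3) T(1)] by blast
      with I'(2) have "(A', B') = I" using I(3) by fastforce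
      with I'(1) show "I' = (r A, r B)" by (simp add: AB)
    qed
  qed
  moreover have "card V \<le> 2 * card (r B)" if "(A, B) \<in> G" for A B
  proof -
    have B: "B \<subseteq> {..<N}" "finite B" using G'(2)[OF that] G'(3)[OF that, of B] finite_subset by auto
    have "card (r B) = card (B \<inter> {..<card V})"
      unfolding r[symmetric] by (rule card_image[symmetric]) (use inj in \<open>auto simp: r_def inj_on_def\<close>)
    \<comment> \<open>At most one point is lost, and the strictness of \<open>N < 2 * card B\<close>
      pays for it: if \<open>card V\<close> is even, then
      \<open>2 * card B \<ge> card V + 2\<close>.\<close>
    moreover have "card B \<le> card (B \<inter> {..<card V}) + card {card V..<N}"
      using card_mono[of "(B \<inter> {..<card V}) \<union> {card V..<N}" B] B card_Un_le[of "B \<inter> {..<card V}" "{card V..<N}"]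
      by fastforce
    ultimately show ?thesis using G(2)[OF that] by (auto simp: N_def split: if_splits)
  qed
  ultimately show ?thesis by (intro exI[of _ ?G]) auto
qed

section \<open>Interval partitions for the monomials outside and inside the intersection
  ideal\<close>

text \<open>These sets are the supports of the monomials of \<open>S/I\<close>. One cube takes all
  subsets of \<open>Y\<close>, including the empty set; what remains are the nonempty subsets of
  \<open>X\<close>, which do not meet the cube because \<open>X\<close> and \<open>Y\<close> are
  disjoint.\<close>

lemma interval_partition_insert_cube:
  assumes G: "interval_partition {T. T \<subseteq> X \<and> T \<noteq> {}} G" and disj: "X \<inter> Y = {}"
  shows "interval_partition {T. T \<subseteq> X \<or> T \<subseteq> Y} (insert ({}, Y) G)"
  unfolding interval_partition_def
proof (intro conjI ballI)
  note G = interval_partitionD[OF G]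
  show "finite (insert ({}, Y) G)" using G(1) by simp
  fix I assume "I \<in> insert ({}, Y) G"
  then show "case I of (A, B) \<Rightarrow> A \<subseteq> B \<and> {A..B} \<subseteq> {T. T \<subseteq> X \<or> T \<subseteq> Y}"
  proof
    assume "I \<in> G"
    then have AB: "(fst I, snd I) \<in> G" by simp
    have "T \<subseteq> X" if "T \<in> {fst I..snd I}" for T
      using G(3)[OF AB, of T] that by simp
    then show ?thesis using G(2)[OF AB] unfolding case_prod_beta by blast
  qed auto
next
  note G = interval_partitionD[OF G]
  have X: "B \<subseteq> X" "A \<noteq> {}" if "(A, B) \<in> G" for A B
    using G(3)[OF that, of B] G(3)[OF that, of A] G(2)[OF that] by simp_all
  fix T assume "T \<in> {T. T \<subseteq> X \<or> T \<subseteq> Y}"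
  then consider "T \<subseteq> Y" | "T \<subseteq> X" "T \<noteq> {}" "\<not> T \<subseteq> Y" by blast
  then show "\<exists>!I. I \<in> insert ({}, Y) G \<and> T \<in> {fst I..snd I}"
  proof cases
    case 1
    show ?thesis
    proof (rule ex1I[of _ "({}, Y)"])
      fix I assume I: "I \<in> insert ({}, Y) G \<and> T \<in> {fst I..snd I}"
      have "I \<notin> G"
      proof
        assume "I \<in> G"
        then have "(fst I, snd I) \<in> G" by simp
        from X[OF this] I 1 disj show False unfolding atLeastAtMost_iff by blast
      qed
      then show "I = ({}, Y)" using I by blast
    qed (use 1 in simp)
  next
    case 2
    have "\<exists>!I. I \<in> G \<and> T \<in> {fst I..snd I}" using 2 by (intro G(4)) simp
    moreover have "T \<notin> {fst ({}, Y)..snd ({}, Y)}" using 2 by simp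
    ultimately show ?thesis by blast
  qed
qed

text \<open>These sets are the supports of the monomials of \<open>I\<close>. Such a set is
  determined by its traces on \<open>X\<close> and \<open>Y\<close>, which vary independently, so
  intervals multiply and the sizes of the upper ends add up.\<close>

lemma interval_partition_product:
  assumes G: "interval_partition {T. T \<subseteq> X \<and> T \<noteq> {}} G" and H: "interval_partition {T. T \<subseteq> Y \<and> T \<noteq> {}} H"
    and disj: "X \<inter> Y = {}"
  shows "interval_partition {T. T \<subseteq> X \<union> Y \<and> T \<inter> X \<noteq> {} \<and> T \<inter> Y \<noteq> {}}
    ((\<lambda>(I, K). (fst I \<union> fst K, snd I \<union> snd K)) ` (G \<times> H))"
proof -
  note G = interval_partitionD[OF G]
  note H = interval_partitionD[OF H]
  let ?u = "\<lambda>(I, K). (fst I \<union> fst K, snd I \<union> snd K)"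
  have mem: "T \<in> {fst I \<union> fst K..snd I \<union> snd K} \<longleftrightarrow>
      T \<inter> X \<in> {fst I..snd I} \<and> T \<inter> Y \<in> {fst K..snd K}"
    if "I \<in> G" "K \<in> H" "T \<subseteq> X \<union> Y" for I K T
  proof -
    have I: "(fst I, snd I) \<in> G" and K: "(fst K, snd K) \<in> H" using that by simp_all
    have "fst I \<subseteq> X" "snd I \<subseteq> X" "fst K \<subseteq> Y" "snd K \<subseteq> Y"
      using G(2)[OF I] G(3)[OF I, of "snd I"] H(2)[OF K] H(3)[OF K, of "snd K"] by auto
    then have "fst I \<union> fst K \<subseteq> T \<longleftrightarrow> fst I \<subseteq> T \<inter> X \<and> fst K \<subseteq> T \<inter> Y"
      "T \<subseteq> snd I \<union> snd K \<longleftrightarrow> T \<inter> X \<subseteq> snd I \<and> T \<inter> Y \<subseteq> snd K"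
      using disj that(3) by blast+
    then show ?thesis unfolding atLeastAtMost_iff by blast
  qed
  have ne: "snd I \<subseteq> X" "fst I \<subseteq> snd I" "fst I \<noteq> {}" if "I \<in> G" for I
    using G(2)[of "fst I" "snd I"] G(3)[of "fst I" "snd I" "fst I"] G(3)[of "fst I" "snd I" "snd I"] that
    by auto
  have ne': "snd I \<subseteq> Y" "fst I \<subseteq> snd I" "fst I \<noteq> {}" if "I \<in> H" for I
    using H(2)[of "fst I" "snd I"] H(3)[of "fst I" "snd I" "fst I"] H(3)[of "fst I" "snd I" "snd I"] that
    by auto
  show ?thesis
    unfolding interval_partition_def
  proof (intro conjI ballI)
    show "finite (?u ` (G \<times> H))" using G(1) H(1) by simp
  next
    fix L assume "L \<in> ?u ` (G \<times> H)"
    then obtain I K where L: "L = (fst I \<union> fst K, snd I \<union> snd K)" "I \<in> G" "K \<in> H" by auto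
    have "T \<subseteq> X \<union> Y \<and> T \<inter> X \<noteq> {} \<and> T \<inter> Y \<noteq> {}"
      if "T \<in> {fst I \<union> fst K..snd I \<union> snd K}" for T
    proof -
      have "fst I \<subseteq> T \<inter> X" "fst K \<subseteq> T \<inter> Y" "T \<subseteq> X \<union> Y"
        using ne(1,2)[OF L(2)] ne'(1,2)[OF L(3)] that unfolding atLeastAtMost_iff by blast+
      then show ?thesis using ne(3)[OF L(2)] ne'(3)[OF L(3)] by blast
    qed
    then show "case L of (A, B) \<Rightarrow> A \<subseteq> B \<and> {A..B} \<subseteq> {T. T \<subseteq> X \<union> Y \<and> T \<inter> X \<noteq> {} \<and> T \<inter> Y \<noteq> {}}"
      using ne(2)[OF L(2)] ne'(2)[OF L(3)] unfolding L(1) prod.case by blast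
  next
    fix T assume T: "T \<in> {T. T \<subseteq> X \<union> Y \<and> T \<inter> X \<noteq> {} \<and> T \<inter> Y \<noteq> {}}"
    then have TXY: "T \<subseteq> X \<union> Y" by simp
    have "\<exists>!I. I \<in> G \<and> T \<inter> X \<in> {fst I..snd I}" using T by (intro G(4)) simp
    then obtain I where I: "I \<in> G \<and> T \<inter> X \<in> {fst I..snd I}"
      "\<forall>I'. I' \<in> G \<and> T \<inter> X \<in> {fst I'..snd I'} \<longrightarrow> I' = I" by (rule ex1E)
    have "\<exists>!K. K \<in> H \<and> T \<inter> Y \<in> {fst K..snd K}" using T by (intro H(4)) simp
    then obtain K where K: "K \<in> H \<and> T \<inter> Y \<in> {fst K..snd K}"
      "\<forall>K'. K' \<in> H \<and> T \<inter> Y \<in> {fst K'..snd K'} \<longrightarrow> K' = K" by (rule ex1E)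
    show "\<exists>!L. L \<in> ?u ` (G \<times> H) \<and> T \<in> {fst L..snd L}"
    proof (rule ex1I[of _ "?u (I, K)"])
      show "?u (I, K) \<in> ?u ` (G \<times> H) \<and> T \<in> {fst (?u (I, K))..snd (?u (I, K))}"
        using I(1) K(1) mem[of I K T] TXY by (intro conjI imageI) simp_all
      fix L assume "L \<in> ?u ` (G \<times> H) \<and> T \<in> {fst L..snd L}"
      then obtain I' K' where L: "L = ?u (I', K')" "I' \<in> G" "K' \<in> H" "T \<in> {fst L..snd L}" by blast
      then have "T \<inter> X \<in> {fst I'..snd I'}" "T \<inter> Y \<in> {fst K'..snd K'}"
        using mem[OF L(2,3) TXY] by simp_all
      then have "I' = I" "K' = K" using I(2) K(2) L(2,3) by blast+
      then show "L = ?u (I, K)" using L(1) by simp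
    qed
  qed
qed

section \<open>Cones and Stanley decompositions\<close>

lemma direct_sum_cong:
  assumes "\<And>i. i \<in> A \<Longrightarrow> F i = G i"
  shows "direct_sum M A F \<longleftrightarrow> direct_sum M A G"
proof -
  have "(\<Pi>\<^sub>E i\<in>A. F i) = (\<Pi>\<^sub>E i\<in>A. G i)" using assms by (rule PiE_cong)
  moreover have "(\<forall>i\<in>A. additive_subgroup (F i) M) \<longleftrightarrow> (\<forall>i\<in>A. additive_subgroup (G i) M)"
    using assms by simp
  ultimately show ?thesis by (simp only: direct_sum_def)
qed

lemma single_eq_0: "Poly_Mapping.single b k = 0 \<longleftrightarrow> k = 0"
  by (metis lookup_single_eq lookup_zero single_zero)

section \<open>Cones of exponents and spans of monomials\<close>

text \<open>The exponents of the monomials in \<open>x^b K[Z]\<close>.\<close>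

definition cone :: "(nat \<Rightarrow>\<^sub>0 nat) \<Rightarrow> nat set \<Rightarrow> (nat \<Rightarrow>\<^sub>0 nat) set" where
  "cone b Z = {c + b |c. Poly_Mapping.keys c \<subseteq> Z}"

lemma base_in_cone: "b \<in> cone b Z"
  by (auto simp: cone_def intro!: exI[of _ 0])

definition monomial_span :: "(nat \<Rightarrow>\<^sub>0 nat) set \<Rightarrow> 'k::field mpoly set" where
  "monomial_span W = {f. Poly_Mapping.keys f \<subseteq> W}"

lemma monomial_span_iff:
  "f \<in> monomial_span W \<longleftrightarrow> (\<forall>b. b \<notin> W \<longrightarrow> Poly_Mapping.lookup f b = 0)"
  by (auto simp: monomial_span_def in_keys_iff)

definition truncate :: "(nat \<Rightarrow>\<^sub>0 nat) set \<Rightarrow> 'k::field mpoly \<Rightarrow> 'k mpoly" where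
  "truncate W f = (\<Sum>b\<in>Poly_Mapping.keys f \<inter> W. Poly_Mapping.single b (Poly_Mapping.lookup f b))"

lemma lookup_truncate:
  "Poly_Mapping.lookup (truncate W f) b = (if b \<in> W then Poly_Mapping.lookup f b else 0)"
  by (auto simp: truncate_def lookup_sum lookup_single when_def in_keys_iff)

lemma truncate_in_span: "truncate W f \<in> monomial_span W"
  by (simp add: monomial_span_iff lookup_truncate)

lemma monomial_span_mono: "V \<subseteq> W \<Longrightarrow> monomial_span V \<subseteq> monomial_span W"
  by (auto simp: monomial_span_def)

lemma monomial_span_closed:
  "0 \<in> monomial_span W"
  "f \<in> monomial_span W \<Longrightarrow> g \<in> monomial_span W \<Longrightarrow> f + g \<in> monomial_span W"
  "f \<in> monomial_span W \<Longrightarrow> - f \<in> monomial_span W"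
  "f \<in> monomial_span W \<Longrightarrow> g \<in> monomial_span W \<Longrightarrow> f - g \<in> monomial_span W"
  by (auto simp: monomial_span_iff lookup_add lookup_minus)

lemma single_in_span [simp]:
  "Poly_Mapping.single b k \<in> monomial_span W \<longleftrightarrow> k = 0 \<or> b \<in> W"
  by (simp add: monomial_span_def)

lemma sum_in_span: "(\<And>i. i \<in> B \<Longrightarrow> f i \<in> monomial_span W) \<Longrightarrow> (\<Sum>i\<in>B. f i) \<in> monomial_span W"
  by (induction B rule: infinite_finite_induct) (auto intro: monomial_span_closed)

lemma times_single_in_cone:
  assumes "u \<in> carrier (poly_ring Z)"
  shows "u * Poly_Mapping.single b k \<in> monomial_span (cone b Z)"
  unfolding monomial_span_def mem_Collect_eq
proof
  fix e assume "e \<in> Poly_Mapping.keys (u * Poly_Mapping.single b k)"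
  then obtain c where "e = c + b" "c \<in> Poly_Mapping.keys u"
    using keys_mult[of u "Poly_Mapping.single b k"] by (auto split: if_splits)
  then show "e \<in> cone b Z" using assms by (auto simp: cone_def carrier_poly_ring)
qed

text \<open>Division by \<open>k x^b\<close> term by term. Subtraction of exponents is truncated; it
  is exact here because all exponents of \<open>f\<close> lie in the cone.\<close>

lemma times_single_onto_cone:
  assumes "f \<in> monomial_span (cone b Z)" "k \<noteq> 0"
  shows "\<exists>u\<in>carrier (poly_ring Z). f = u * Poly_Mapping.single b k"
proof -
  let ?s = "\<lambda>c. Poly_Mapping.single (c - b) (Poly_Mapping.lookup f c / k)"
  define u where "u = (\<Sum>c\<in>Poly_Mapping.keys f. ?s c)"
  have c: "Poly_Mapping.keys (c - b) \<subseteq> Z" "c - b + b = c" if "c \<in> Poly_Mapping.keys f" for c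
  proof -
    have "c \<in> cone b Z" using assms(1) that by (auto simp: monomial_span_def)
    then obtain d where "c = d + b" "Poly_Mapping.keys d \<subseteq> Z" by (auto simp: cone_def)
    then show "Poly_Mapping.keys (c - b) \<subseteq> Z" "c - b + b = c" by simp_all
  qed
  have "u \<in> carrier (poly_ring Z)"
  proof -
    have "u \<in> monomial_span {c. Poly_Mapping.keys c \<subseteq> Z}"
      unfolding u_def by (intro sum_in_span) (simp add: c)
    then show ?thesis by (auto simp: monomial_span_def carrier_poly_ring)
  qed
  moreover have "u * Poly_Mapping.single b k =
      (\<Sum>c\<in>Poly_Mapping.keys f. Poly_Mapping.single c (Poly_Mapping.lookup f c))"
    unfolding u_def sum_distrib_right
    by (intro sum.cong) (simp_all add: mult_single c assms(2))
  ultimately show ?thesis by (auto simp: sum_singles)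
qed

text \<open>A subquotient of the polynomial ring by monomial ideals: \<open>J\<close> is the set of monomials of the
  larger ideal, \<open>\<Omega>\<close> the set of those outside the smaller one, and \<open>\<phi>\<close> the projection.\<close>

locale monomial_subquotient = multigraded_module p M component
  for p :: nat and M :: "('k::field mpoly, 'm) module" (structure)
    and component :: "(nat \<Rightarrow> int) \<Rightarrow> 'm set" +
  fixes J \<Omega> :: "(nat \<Rightarrow>\<^sub>0 nat) set" and \<phi> :: "'k mpoly \<Rightarrow> 'm"
  assumes J_keys: "b \<in> J \<Longrightarrow> Poly_Mapping.keys b \<subseteq> {1..p}"
    and J_add: "b \<in> J \<Longrightarrow> Poly_Mapping.keys c \<subseteq> {1..p} \<Longrightarrow> c + b \<in> J"
    and \<Omega>_subset: "\<Omega> \<subseteq> J"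
    and \<phi>_closed: "f \<in> monomial_span J \<Longrightarrow> \<phi> f \<in> carrier M"
    and \<phi>_add: "f \<in> monomial_span J \<Longrightarrow> g \<in> monomial_span J \<Longrightarrow> \<phi> (f + g) = \<phi> f \<oplus> \<phi> g"
    and \<phi>_smult: "u \<in> carrier (poly_ring {1..p}) \<Longrightarrow> f \<in> monomial_span J \<Longrightarrow> u \<odot> \<phi> f = \<phi> (u * f)"
    and \<phi>_surj: "x \<in> carrier M \<Longrightarrow> \<exists>f\<in>monomial_span \<Omega>. x = \<phi> f"
    and \<phi>_zero: "f \<in> monomial_span J \<Longrightarrow> \<phi> f = \<zero> \<longleftrightarrow> Poly_Mapping.keys f \<inter> \<Omega> = {}"
    and component_eq: "a \<in> degrees p \<Longrightarrow> component a = \<phi> ` (monomial_span J \<inter> poly_component a)"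
begin

lemma span_\<Omega>_J: "f \<in> monomial_span \<Omega> \<Longrightarrow> f \<in> monomial_span J"
  using monomial_span_mono[OF \<Omega>_subset] by blast

lemma \<phi>_0: "\<phi> 0 = \<zero>"
  by (simp add: \<phi>_zero monomial_span_closed)

lemma \<phi>_uminus: "f \<in> monomial_span J \<Longrightarrow> \<ominus> \<phi> f = \<phi> (- f)"
  using \<phi>_add[of "- f" f] \<phi>_0 by (intro M.minus_equality) (auto simp: \<phi>_closed monomial_span_closed)

lemma \<phi>_zero_\<Omega>: "f \<in> monomial_span \<Omega> \<Longrightarrow> \<phi> f = \<zero> \<longleftrightarrow> f = 0"
  using \<phi>_zero[OF span_\<Omega>_J, of f] by (auto simp: monomial_span_def Int_absorb2)

text \<open>On the span of \<open>\<Omega>\<close> the additive map \<open>\<phi>\<close> has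
  trivial kernel. Together with \<open>\<phi>_surj\<close> this makes the images of the monomials of
  \<open>\<Omega>\<close> a \<open>K\<close>-basis of \<open>M\<close>.\<close>

lemma \<phi>_inj:
  assumes "f \<in> monomial_span \<Omega>" "g \<in> monomial_span \<Omega>" "\<phi> f = \<phi> g"
  shows "f = g"
proof -
  have c: "f - g \<in> monomial_span \<Omega>" using assms(1,2) by (rule monomial_span_closed)
  have "\<phi> (f - g) \<oplus> \<phi> g = \<zero> \<oplus> \<phi> g"
    using \<phi>_add[of "f - g" g] span_\<Omega>_J[OF c] span_\<Omega>_J[OF assms(2)] assms(3) \<phi>_closed by simp
  then have "\<phi> (f - g) = \<zero>"
    using \<phi>_closed span_\<Omega>_J[OF c] span_\<Omega>_J[OF assms(2)] M.add.right_cancel by blast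
  then show ?thesis using \<phi>_zero_\<Omega>[OF c] by simp
qed

lemma \<phi>_sum:
  assumes "finite B" "\<And>i. i \<in> B \<Longrightarrow> f i \<in> monomial_span J"
  shows "\<phi> (\<Sum>i\<in>B. f i) = (\<Oplus>i\<in>B. \<phi> (f i))"
  using assms
proof (induction B rule: finite_induct)
  case empty
  then show ?case by (simp add: \<phi>_0)
next
  case (insert i B)
  have "(\<lambda>i. \<phi> (f i)) \<in> B \<rightarrow> carrier M" "\<phi> (f i) \<in> carrier M"
    using insert.prems \<phi>_closed by auto
  then have "(\<Oplus>i\<in>insert i B. \<phi> (f i)) = \<phi> (f i) \<oplus> (\<Oplus>i\<in>B. \<phi> (f i))"
    using insert.hyps by simp
  moreover have "\<phi> (\<Sum>i\<in>insert i B. f i) = \<phi> (f i) \<oplus> \<phi> (\<Sum>i\<in>B. f i)"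
    using insert.hyps insert.prems by (simp add: \<phi>_add sum_in_span)
  ultimately show ?case using insert.IH insert.prems by simp
qed

lemma additive_subgroup_\<phi>_span:
  assumes "W \<subseteq> J"
  shows "additive_subgroup (\<phi> ` monomial_span W) M"
proof (rule additive_subgroup.intro, rule M.add.subgroupI)
  have W: "f \<in> monomial_span J" if "f \<in> monomial_span W" for f :: "'k mpoly"
    using that monomial_span_mono[OF assms] by blast
  show "\<phi> ` monomial_span W \<subseteq> carrier M" using W \<phi>_closed by blast
  show "\<phi> ` monomial_span W \<noteq> {}" using monomial_span_closed(1) by blast
  fix x y assume "x \<in> \<phi> ` monomial_span W"
  then obtain f where f: "f \<in> monomial_span W" "x = \<phi> f" by blast
  show "\<ominus> x \<in> \<phi> ` monomial_span W"
    unfolding f(2) \<phi>_uminus[OF W[OF f(1)]] using f(1) by (intro imageI monomial_span_closed)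
  assume "y \<in> \<phi> ` monomial_span W"
  then obtain g where g: "g \<in> monomial_span W" "y = \<phi> g" by blast
  show "x \<oplus> y \<in> \<phi> ` monomial_span W"
    unfolding f(2) g(2) \<phi>_add[OF W[OF f(1)] W[OF g(1)], symmetric]
    using f(1) g(1) by (intro imageI monomial_span_closed)
qed

section \<open>Direct sum decompositions correspond to partitions of the exponents\<close>

text \<open>A representative in the span of \<open>\<Omega>\<close> is split according to the blocks
  that contain its exponents. A vanishing sum has vanishing summands because each coefficient occurs
  in only one of them.\<close>

lemma direct_sum_spans:
  assumes W: "\<And>i. i \<in> A \<Longrightarrow> W i \<subseteq> \<Omega>" and A: "finite A"
    and partition: "\<And>b. b \<in> \<Omega> \<Longrightarrow> \<exists>!i. i \<in> A \<and> b \<in> W i"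
  shows "direct_sum M A (\<lambda>i. \<phi> ` monomial_span (W i))"
proof (rule direct_sumI[OF M.abelian_group_axioms])
  fix i assume "i \<in> A"
  then show "additive_subgroup (\<phi> ` monomial_span (W i)) M"
    using W \<Omega>_subset by (intro additive_subgroup_\<phi>_span) blast
next
  fix x assume "x \<in> carrier M"
  then obtain f where f: "f \<in> monomial_span \<Omega>" "x = \<phi> f" using \<phi>_surj by blast
  have "(\<Sum>i\<in>A. truncate (W i) f) = f"
  proof (rule poly_mapping_eqI)
    fix b
    have "(\<Sum>i\<in>A. if b \<in> W i then Poly_Mapping.lookup f b else 0) = Poly_Mapping.lookup f b"
    proof (cases "b \<in> \<Omega>")
      case True
      obtain i where i: "i \<in> A \<and> b \<in> W i" "\<forall>j. j \<in> A \<and> b \<in> W j \<longrightarrow> j = i"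
        using partition[OF True] by (rule ex1E)
      then have "b \<in> W j \<longleftrightarrow> j = i" if "j \<in> A" for j
        using that by blast
      then have "(\<Sum>i\<in>A. if b \<in> W i then Poly_Mapping.lookup f b else 0) =
          (\<Sum>j\<in>A. if j = i then Poly_Mapping.lookup f b else 0)"
        by (intro sum.cong) simp_all
      then show ?thesis using i(1) A by simp
    next
      case False
      then have "Poly_Mapping.lookup f b = 0"
        using f(1) by (simp add: monomial_span_iff)
      then show ?thesis by (simp add: sum.neutral)
    qed
    then show "Poly_Mapping.lookup (\<Sum>i\<in>A. truncate (W i) f) b = Poly_Mapping.lookup f b"
      by (simp add: lookup_sum lookup_truncate)
  qed
  moreover have "truncate (W i) f \<in> monomial_span J" if "i \<in> A" for i
    using truncate_in_span monomial_span_mono[OF W[OF that]] by (blast intro: span_\<Omega>_J)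
  ultimately have "x = (\<Oplus>i\<in>A. \<phi> (truncate (W i) f))"
    using \<phi>_sum[OF A, of "\<lambda>i. truncate (W i) f"] f(2) by simp
  then show "\<exists>B h. finite B \<and> B \<subseteq> A \<and> (\<forall>i\<in>B. h i \<in> \<phi> ` monomial_span (W i)) \<and> x = (\<Oplus>i\<in>B. h i)"
    using A truncate_in_span by (intro exI[of _ A] exI[of _ "\<lambda>i. \<phi> (truncate (W i) f)"]) auto
next
  fix B h assume B: "finite B" "B \<subseteq> A" "\<And>i. i \<in> B \<Longrightarrow> h i \<in> \<phi> ` monomial_span (W i)"
    and z: "(\<Oplus>i\<in>B. h i) = \<zero>"
  then have "\<forall>i\<in>B. \<exists>f. f \<in> monomial_span (W i) \<and> h i = \<phi> f" by blast
  from bchoice[OF this] obtain g where "\<forall>i\<in>B. g i \<in> monomial_span (W i) \<and> h i = \<phi> (g i)" ..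
  then have g: "g i \<in> monomial_span (W i)" "h i = \<phi> (g i)" if "i \<in> B" for i
    using that by auto
  have g\<Omega>: "g i \<in> monomial_span \<Omega>" if "i \<in> B" for i
    using g(1)[OF that] monomial_span_mono[OF W] B(2) that by blast
  have "(\<Oplus>i\<in>B. h i) = (\<Oplus>i\<in>B. \<phi> (g i))"
    by (rule M.finsum_cong') (use g(2) g\<Omega> span_\<Omega>_J \<phi>_closed in auto)
  also have "\<dots> = \<phi> (\<Sum>i\<in>B. g i)" 
    by (rule \<phi>_sum[OF B(1), symmetric]) (use g\<Omega> span_\<Omega>_J in blast)
  finally have sum: "(\<Sum>i\<in>B. g i) = 0"
    using z \<phi>_zero_\<Omega>[OF sum_in_span, of B g] g\<Omega> by simp
  have "g i = 0" if i: "i \<in> B" for i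
  proof (rule poly_mapping_eqI)
    fix b
    show "Poly_Mapping.lookup (g i) b = Poly_Mapping.lookup 0 b"
    proof (cases "b \<in> W i")
      case True
      have "b \<in> \<Omega>" using W True i B(2) by blast
      have "b \<notin> W j" if "j \<in> B" "j \<noteq> i" for j
        using partition[OF \<open>b \<in> \<Omega>\<close>] that True i B(2) by blast
      then have "Poly_Mapping.lookup (g j) b = 0" if "j \<in> B - {i}" for j
        using g(1)[of j] that by (simp add: monomial_span_iff)
      then have "Poly_Mapping.lookup (\<Sum>i\<in>B. g i) b = Poly_Mapping.lookup (g i) b"
        unfolding lookup_sum by (subst sum.remove[OF B(1) i]) simp
      then show ?thesis using sum by simp
    next
      case False
      then show ?thesis using g(1)[OF i] by (simp add: monomial_span_iff)
    qed
  qed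
  then show "\<forall>i\<in>B. h i = \<zero>" using g(2) \<phi>_0 by simp
qed

text \<open>The image of the single monomial \<open>x^b\<close> is decomposed. Existence of its
  decomposition puts \<open>b\<close> into some block, uniqueness into only one.\<close>

lemma partition_of_direct_sum:
  assumes sum: "direct_sum M A (\<lambda>i. \<phi> ` monomial_span (W i))"
    and W: "\<And>i. i \<in> A \<Longrightarrow> W i \<subseteq> \<Omega>" and b: "b \<in> \<Omega>"
  shows "\<exists>!i. i \<in> A \<and> b \<in> W i"
proof -
  let ?x = "\<phi> (Poly_Mapping.single b 1)"
  let ?F = "\<lambda>i. \<phi> ` monomial_span (W i)"
  let ?R = "\<lambda>f. f \<in> (\<Pi>\<^sub>E i\<in>A. ?F i) \<and> finite {i\<in>A. f i \<noteq> \<zero>} \<and> ?x = (\<Oplus>i\<in>{i\<in>A. f i \<noteq> \<zero>}. f i)"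
  have b\<Omega>: "Poly_Mapping.single b (1::'k) \<in> monomial_span \<Omega>" using b by simp
  have x: "?x \<in> carrier M" "?x \<noteq> \<zero>"
    using \<phi>_closed[OF span_\<Omega>_J[OF b\<Omega>]] \<phi>_zero_\<Omega>[OF b\<Omega>] by (auto simp: single_eq_0)
  then have ex1: "\<exists>!f. ?R f" using sum unfolding direct_sum_def by blast
  show ?thesis
  proof (rule ex_ex1I)
    from ex1 obtain f where f: "?R f" by blast
    let ?B = "{i\<in>A. f i \<noteq> \<zero>}"
    have "\<forall>i\<in>?B. \<exists>g. g \<in> monomial_span (W i) \<and> f i = \<phi> g"
      using f by blast
    from bchoice[OF this] obtain g where "\<forall>i\<in>?B. g i \<in> monomial_span (W i) \<and> f i = \<phi> (g i)" ..
    then have g: "g i \<in> monomial_span (W i)" "f i = \<phi> (g i)" if "i \<in> ?B" for i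
      using that by blast+
    have g\<Omega>: "g i \<in> monomial_span \<Omega>" if "i \<in> ?B" for i
      using g(1)[OF that] monomial_span_mono[OF W, of i] that by blast
    have "?x = (\<Oplus>i\<in>?B. f i)" using f by blast
    also have "\<dots> = (\<Oplus>i\<in>?B. \<phi> (g i))"
    proof (rule M.finsum_cong')
      show "(\<lambda>i. \<phi> (g i)) \<in> ?B \<rightarrow> carrier M"
        using \<phi>_closed[OF span_\<Omega>_J[OF g\<Omega>]] by blast
    qed (simp_all only: g(2))
    also have "\<dots> = \<phi> (\<Sum>i\<in>?B. g i)"
      by (rule \<phi>_sum[symmetric]) (use f g\<Omega> span_\<Omega>_J in blast)+
    finally have "?x = \<phi> (\<Sum>i\<in>?B. g i)" .
    moreover have "(\<Sum>i\<in>?B. g i) \<in> monomial_span \<Omega>"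
      by (rule sum_in_span) (rule g\<Omega>)
    ultimately have "Poly_Mapping.single b 1 = (\<Sum>i\<in>?B. g i)"
      using b\<Omega> by (intro \<phi>_inj)
    \<comment> \<open>The coefficients at \<open>b\<close> sum to \<open>1\<close>, so some summand
      has \<open>b\<close> among its exponents.\<close>
    then have "(\<Sum>i\<in>?B. Poly_Mapping.lookup (g i) b) \<noteq> 0"
      by (metis lookup_sum lookup_single_eq zero_neq_one)
    then obtain i where i: "i \<in> ?B" "Poly_Mapping.lookup (g i) b \<noteq> 0"
      by (meson sum.not_neutral_contains_not_neutral)
    then have "b \<in> W i" using g(1)[OF i(1)] by (simp add: monomial_span_iff) blast
    moreover have "i \<in> A" using i(1) by blast
    ultimately show "\<exists>i. i \<in> A \<and> b \<in> W i" by blast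
  next
    fix i j assume i: "i \<in> A \<and> b \<in> W i" and j: "j \<in> A \<and> b \<in> W j"
    \<comment> \<open>If \<open>b\<close> lies in two blocks, the nonzero element \<open>?x\<close>
      may be placed in either slot, giving two decompositions of it.\<close>
    let ?f = "\<lambda>k. \<lambda>l\<in>A. if l = k then ?x else \<zero>"
    have "?R (?f k)" if k: "k \<in> A \<and> b \<in> W k" for k
    proof -
      have "?f k l \<noteq> \<zero> \<longleftrightarrow> l = k" if "l \<in> A" for l
        using that x(2) by simp
      then have s: "{i\<in>A. ?f k i \<noteq> \<zero>} = {k}" using k by blast
      have "?f k \<in> (\<Pi>\<^sub>E i\<in>A. ?F i)"
      proof (rule PiE_I)
        fix l assume "l \<in> A"
        show "?f k l \<in> ?F l"
        proof (cases "l = k")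
          case True
          then show ?thesis using k by simp
        next
          case False
          have "\<zero> \<in> ?F l"
            unfolding \<phi>_0[symmetric] by (intro imageI monomial_span_closed)
          then show ?thesis using False \<open>l \<in> A\<close> by simp
        qed
      qed simp
      moreover have "?x = (\<Oplus>i\<in>{k}. ?f k i)" using k x(1) by simp
      ultimately show ?thesis unfolding s by blast
    qed
    from this[OF i] this[OF j] ex1 have "?f i = ?f j" by blast
    then have "?f i i = ?f j i" by (rule fun_cong)
    then show "i = j" using i x(2) by (auto split: if_splits)
  qed
qed

lemma stanley_space_\<phi>:
  assumes "b \<in> J" "k \<noteq> 0" "Z \<subseteq> {1..p}"
  shows "stanley_space (\<phi> (Poly_Mapping.single b k)) Z = \<phi> ` monomial_span (cone b Z)"
proof -
  have "u \<odot> \<phi> (Poly_Mapping.single b k) = \<phi> (u * Poly_Mapping.single b k)"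
    if "u \<in> carrier (poly_ring Z)" for u
    using that assms(1,3) by (intro \<phi>_smult) (auto simp: carrier_poly_ring)
  then have "stanley_space (\<phi> (Poly_Mapping.single b k)) Z =
      \<phi> ` (\<lambda>u. u * Poly_Mapping.single b k) ` carrier (poly_ring Z)"
    by (simp add: stanley_space_def image_image)
  also have "(\<lambda>u. u * Poly_Mapping.single b k) ` carrier (poly_ring Z) = monomial_span (cone b Z)"
    using times_single_in_cone times_single_onto_cone[OF _ assms(2)] by blast
  finally show ?thesis .
qed

text \<open>Polynomial components are at most one-dimensional, so a homogeneous element is the image
  of one term. Freeness, tested on the monomials \<open>x^c\<close> with support in
  \<open>Z\<close>, says that no \<open>x^c x^b\<close> falls into the smaller ideal, that is, the
  whole cone stays in \<open>\<Omega>\<close>.\<close>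

lemma free_generator:
  assumes "homogeneous x" "Z \<subseteq> {1..p}" "\<forall>u\<in>carrier (poly_ring Z). u \<odot> x = \<zero> \<longrightarrow> u = 0"
  shows "\<exists>b k. b \<in> J \<and> k \<noteq> 0 \<and> x = \<phi> (Poly_Mapping.single b k) \<and> cone b Z \<subseteq> \<Omega>"
proof -
  obtain a where a: "a \<in> degrees p" "x \<in> component a"
    using assms(1) by (auto simp: homogeneous_def)
  then obtain f where f: "x = \<phi> f" "f \<in> monomial_span J" "f \<in> poly_component a"
    using component_eq by blast
  have x: "x \<in> carrier M" using f \<phi>_closed by blast
  have "\<one>\<^bsub>poly_ring {1..p}\<^esub> \<odot> x = x" using x by (rule smult_one)
  \<comment> \<open>Freeness is applied to \<open>u = 1\<close>.\<close>
  then have "x \<noteq> \<zero>" using assms(3) poly_ring_01_closed(2) by force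
  then have "f \<noteq> 0" using f(1) \<phi>_0 by blast
  then obtain b where b: "b \<in> Poly_Mapping.keys f" by fastforce
  define k where "k = Poly_Mapping.lookup f b"
  have k: "k \<noteq> 0" "f = Poly_Mapping.single b k"
    using b poly_component_eq_single[OF f(3) b] by (auto simp: k_def in_keys_iff)
  have bJ: "b \<in> J" using b f(2) by (auto simp: monomial_span_def)
  have "cone b Z \<subseteq> \<Omega>"
  proof
    fix e assume "e \<in> cone b Z"
    then obtain c where c: "e = c + b" "Poly_Mapping.keys c \<subseteq> Z" by (auto simp: cone_def)
    have u: "Poly_Mapping.single c (1::'k) \<in> carrier (poly_ring Z)"
      using c(2) by (simp add: carrier_poly_ring)
    then have "Poly_Mapping.single c (1::'k) \<odot> x \<noteq> \<zero>"
      using assms(3) by (metis single_eq_0 zero_neq_one)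
    moreover have "Poly_Mapping.single c (1::'k) \<odot> x = \<phi> (Poly_Mapping.single e k)"
    proof -
      have "Poly_Mapping.single c (1::'k) \<in> carrier (poly_ring {1..p})"
        using c(2) assms(2) by (auto simp: carrier_poly_ring)
      then show ?thesis using \<phi>_smult[OF _ f(2)] by (simp add: f(1) k(2) c(1) mult_single)
    qed
    moreover have "Poly_Mapping.single e k \<in> monomial_span J"
      using J_add[OF bJ, of c] c assms(2) by auto
    ultimately have "Poly_Mapping.keys (Poly_Mapping.single e k) \<inter> \<Omega> \<noteq> {}"
      using \<phi>_zero by metis
    then show "e \<in> \<Omega>" by (auto split: if_splits)
  qed
  then show ?thesis using bJ k f(1) by blast
qed

text \<open>For upper bounds: only the combinatorics of a partition of \<open>\<Omega>\<close> into
  cones is left. The vertices come from \<open>free_generator\<close>.\<close>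

lemma cones_of_stanley_decomposition:
  assumes D: "stanley_decomposition D"
  obtains b where "\<And>i. i < length D \<Longrightarrow> cone (b i) (snd (D ! i)) \<subseteq> \<Omega>"
    and "\<And>e. e \<in> \<Omega> \<Longrightarrow> \<exists>!i. i < length D \<and> e \<in> cone (b i) (snd (D ! i))"
proof -
  have Z: "snd (D ! i) \<subseteq> {1..p}" if "i < length D" for i
    using D nth_mem[OF that] unfolding stanley_decomposition_def by (auto simp: case_prod_beta)
  have "\<exists>b k. b \<in> J \<and> k \<noteq> 0 \<and> fst (D ! i) = \<phi> (Poly_Mapping.single b k) \<and> cone b (snd (D ! i)) \<subseteq> \<Omega>"
    if "i < length D" for i
  proof (rule free_generator[OF _ Z[OF that]])
    have "(fst (D ! i), snd (D ! i)) \<in> set D" using that by simp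
    with D show "homogeneous (fst (D ! i))"
      "\<forall>u\<in>carrier (poly_ring (snd (D ! i))). u \<odot> fst (D ! i) = \<zero> \<longrightarrow> u = 0"
      unfolding stanley_decomposition_def by blast+
  qed
  then have "\<forall>i\<in>{..<length D}. \<exists>b. \<exists>k. b \<in> J \<and> k \<noteq> 0 \<and> fst (D ! i) = \<phi> (Poly_Mapping.single b k) \<and>
      cone b (snd (D ! i)) \<subseteq> \<Omega>" by blast
  from bchoice[OF this] obtain b where b: "\<And>i. i < length D \<Longrightarrow> \<exists>k. b i \<in> J \<and> k \<noteq> 0 \<and>
      fst (D ! i) = \<phi> (Poly_Mapping.single (b i) k) \<and> cone (b i) (snd (D ! i)) \<subseteq> \<Omega>"
    by auto
  have sp: "stanley_space (fst (D ! i)) (snd (D ! i)) = \<phi> ` monomial_span (cone (b i) (snd (D ! i)))"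
    if "i < length D" for i
    using b[OF that] stanley_space_\<phi> Z[OF that] by auto
  have "direct_sum M {..<length D} (\<lambda>i. stanley_space (fst (D ! i)) (snd (D ! i)))"
    using D by (simp add: stanley_decomposition_def)
  also have "direct_sum M {..<length D} (\<lambda>i. stanley_space (fst (D ! i)) (snd (D ! i))) =
    direct_sum M {..<length D} (\<lambda>i. \<phi> ` monomial_span (cone (b i) (snd (D ! i))))"
    by (rule direct_sum_cong) (simp add: sp)
  finally have "\<exists>!i. i \<in> {..<length D} \<and> e \<in> cone (b i) (snd (D ! i))" if "e \<in> \<Omega>" for e
    by (rule partition_of_direct_sum[OF _ _ that]) (use b in auto)
  moreover have "cone (b i) (snd (D ! i)) \<subseteq> \<Omega>" if "i < length D" for i
    using b[OF that] by blast
  ultimately show ?thesis by (intro that[of b]) auto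
qed

text \<open>The converse passage, for lower bounds.\<close>

lemma stanley_decomposition_of_cones:
  assumes Z: "\<And>i. i < length bs \<Longrightarrow> snd (bs ! i) \<subseteq> {1..p}"
    and \<Omega>: "\<And>i. i < length bs \<Longrightarrow> cone (fst (bs ! i)) (snd (bs ! i)) \<subseteq> \<Omega>"
    and partition: "\<And>e. e \<in> \<Omega> \<Longrightarrow> \<exists>!i. i < length bs \<and> e \<in> cone (fst (bs ! i)) (snd (bs ! i))"
  shows "stanley_decomposition (map (\<lambda>(b, Z). (\<phi> (Poly_Mapping.single b 1), Z)) bs)"
proof -
  let ?D = "map (\<lambda>(b, Z). (\<phi> (Poly_Mapping.single b (1::'k)), Z)) bs"
  have nth: "?D ! i = (\<phi> (Poly_Mapping.single (fst (bs ! i)) 1), snd (bs ! i))" if "i < length bs" for i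
    using that by (simp add: case_prod_beta)
  have J: "fst (bs ! i) \<in> J" if "i < length bs" for i
    using \<Omega>[OF that] \<Omega>_subset base_in_cone by blast
  have "direct_sum M {..<length bs} (\<lambda>i. \<phi> ` monomial_span (cone (fst (bs ! i)) (snd (bs ! i))))"
    using \<Omega> partition by (intro direct_sum_spans) auto
  also have "direct_sum M {..<length bs} (\<lambda>i. \<phi> ` monomial_span (cone (fst (bs ! i)) (snd (bs ! i)))) =
      direct_sum M {..<length bs} (\<lambda>i. stanley_space (fst (?D ! i)) (snd (?D ! i)))"
    by (rule direct_sum_cong) (simp add: nth stanley_space_\<phi>[OF J _ Z] del: nth_map)
  finally have sum: "direct_sum M {..<length ?D} (\<lambda>i. stanley_space (fst (?D ! i)) (snd (?D ! i)))"
    by simp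
  have "homogeneous x \<and> Z \<subseteq> {1..p} \<and> (\<forall>u\<in>carrier (poly_ring Z). u \<odot> x = \<zero> \<longrightarrow> u = 0)"
    if xZ: "(x, Z) \<in> set ?D" for x Z
  proof -
    from xZ obtain i where i: "i < length bs" "?D ! i = (x, Z)"
      by (auto simp only: in_set_conv_nth length_map)
    define b where "b = fst (bs ! i)"
    have b: "x = \<phi> (Poly_Mapping.single b 1)" "snd (bs ! i) = Z" "b \<in> J"
      using i nth[OF i(1)] J[OF i(1)] by (auto simp: b_def)
    have Zp: "Z \<subseteq> {1..p}" using Z[OF i(1)] b(2) by simp
    have deg: "exponent_degree b \<in> degrees p" using J_keys[OF b(3)] by (simp add: exponent_degree_in_degrees)
    have "Poly_Mapping.single b (1::'k) \<in> monomial_span J \<inter> poly_component (exponent_degree b)"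
      using b(3) by (simp add: poly_component_def)
    then have "homogeneous x" unfolding homogeneous_def b(1) using component_eq[OF deg] deg by blast
    moreover have "u = 0" if u: "u \<in> carrier (poly_ring Z)" "u \<odot> x = \<zero>" for u
    proof -
      have u': "u \<in> carrier (poly_ring {1..p})" using u(1) Zp by (auto simp: carrier_poly_ring)
      have "u \<odot> x = \<phi> (u * Poly_Mapping.single b 1)"
        unfolding b(1) by (rule \<phi>_smult[OF u']) (simp add: b(3))
      \<comment> \<open>The product is supported in the cone, hence in \<open>\<Omega>\<close>,
        where \<open>\<phi>\<close> kills only \<open>0\<close>. Freeness thus reduces to cancelling
        a monomial.\<close>
      moreover have "u * Poly_Mapping.single b 1 \<in> monomial_span \<Omega>"
        using times_single_in_cone[OF u(1)] monomial_span_mono[OF \<Omega>[OF i(1)]] b(2) b_def by blast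
      ultimately have "u * Poly_Mapping.single b 1 = 0" using u(2) \<phi>_zero_\<Omega> by metis
      then show "u = 0" by (simp add: single_eq_0)
    qed
    ultimately show ?thesis using Zp by blast
  qed
  then show ?thesis unfolding stanley_decomposition_def using sum by blast
qed

section \<open>Bounding the Stanley depth through cone partitions\<close>

lemma finite_sdepth_values: "finite {sdepth_decomposition D |D. stanley_decomposition D}"
proof (rule finite_subset)
  \<comment> \<open>The unspecified value \<open>Min {}\<close> accounts for the empty
    decomposition; all other values are sizes of subsets of \<open>{1..p}\<close>.\<close>
  show "{sdepth_decomposition D |D. stanley_decomposition D} \<subseteq> insert (Min {}) {..p}"
  proof
    fix d assume "d \<in> {sdepth_decomposition D |D. stanley_decomposition D}"
    then obtain D where D: "stanley_decomposition D" "d = sdepth_decomposition D" by blast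
    show "d \<in> insert (Min {}) {..p}"
    proof (cases "D = []")
      case True
      then show ?thesis using D(2) by (simp add: sdepth_decomposition_def)
    next
      case False
      have "d \<in> (\<lambda>(x, Z). card Z) ` set D"
        unfolding D(2) sdepth_decomposition_def using False by (intro Min_in) auto
      then obtain x Z where "(x, Z) \<in> set D" "d = card Z" by auto
      then have "Z \<subseteq> {1..p}" "d = card Z" using D(1) by (auto simp: stanley_decomposition_def)
      then have "d \<le> card {1..p}" using card_mono[of "{1..p}" Z] by simp
      then show ?thesis by simp
    qed
  qed
qed simp

text \<open>Since \<open>\<Omega>\<close> is nonempty, there is at least one cone, so
  \<open>Min\<close> is taken over a nonempty set. The existence statement is recorded because upper
  bounds rely on it.\<close>

lemma sdepth_ge:
  assumes "\<Omega> \<noteq> {}"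
    and "\<And>i. i < length bs \<Longrightarrow> snd (bs ! i) \<subseteq> {1..p}"
    and "\<And>i. i < length bs \<Longrightarrow> cone (fst (bs ! i)) (snd (bs ! i)) \<subseteq> \<Omega>"
    and "\<And>e. e \<in> \<Omega> \<Longrightarrow> \<exists>!i. i < length bs \<and> e \<in> cone (fst (bs ! i)) (snd (bs ! i))"
    and "\<And>i. i < length bs \<Longrightarrow> d \<le> card (snd (bs ! i))"
  shows "\<exists>D. stanley_decomposition D" and "d \<le> sdepth"
proof -
  let ?D = "map (\<lambda>(b, Z). (\<phi> (Poly_Mapping.single b (1::'k)), Z)) bs"
  have D: "stanley_decomposition ?D"
    using assms(2-4) by (rule stanley_decomposition_of_cones)
  then show "\<exists>D. stanley_decomposition D" by blast
  obtain e where "e \<in> \<Omega>" using assms(1) by blast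
  from assms(4)[OF this] have "bs \<noteq> []" by auto
  have "d \<le> card Z" if "(b, Z) \<in> set bs" for b Z
    using that assms(5) by (metis in_set_conv_nth snd_conv)
  then have "d \<le> sdepth_decomposition ?D"
    unfolding sdepth_decomposition_def using \<open>bs \<noteq> []\<close> by (subst Min_ge_iff) auto
  also have "\<dots> \<le> sdepth"
    unfolding sdepth_def using D by (intro Max_ge finite_sdepth_values) blast
  finally show "d \<le> sdepth" .
qed

text \<open>A maximum can be bounded from above only if some decomposition exists, hence the first
  hypothesis. The second presents an arbitrary decomposition through its cones.\<close>

lemma sdepth_le:
  assumes "\<exists>D. stanley_decomposition D"
    and "\<And>D b. \<lbrakk>stanley_decomposition D;
        \<And>i. i < length D \<Longrightarrow> cone (b i) (snd (D ! i)) \<subseteq> \<Omega>;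
        \<And>e. e \<in> \<Omega> \<Longrightarrow> \<exists>!i. i < length D \<and> e \<in> cone (b i) (snd (D ! i));
        \<And>i. i < length D \<Longrightarrow> sdepth_decomposition D \<le> card (snd (D ! i))\<rbrakk>
      \<Longrightarrow> sdepth_decomposition D \<le> d"
  shows "sdepth \<le> d"
proof -
  have "sdepth_decomposition D \<le> d" if D: "stanley_decomposition D" for D
  proof -
    have le: "sdepth_decomposition D \<le> card (snd (D ! i))" if "i < length D" for i
      unfolding sdepth_decomposition_def
      using nth_mem[OF that] by (intro Min_le) (auto simp: case_prod_beta)
    obtain b where "\<And>i. i < length D \<Longrightarrow> cone (b i) (snd (D ! i)) \<subseteq> \<Omega>"
        "\<And>e. e \<in> \<Omega> \<Longrightarrow> \<exists>!i. i < length D \<and> e \<in> cone (b i) (snd (D ! i))"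
      using cones_of_stanley_decomposition[OF D] by blast
    then show ?thesis using assms(2)[OF D] le by blast
  qed
  then show ?thesis
    unfolding sdepth_def using assms(1) finite_sdepth_values by (subst Max_le_iff) auto
qed

end

definition squarefree_exponent :: "nat set \<Rightarrow> nat \<Rightarrow>\<^sub>0 nat" where
  "squarefree_exponent A = (\<Sum>i\<in>A. Poly_Mapping.single i 1)"

lemma lookup_squarefree_exponent:
  "finite A \<Longrightarrow> Poly_Mapping.lookup (squarefree_exponent A) i = (if i \<in> A then 1 else 0)"
  by (simp add: squarefree_exponent_def lookup_sum lookup_single when_def)

lemma keys_squarefree_exponent: "finite A \<Longrightarrow> Poly_Mapping.keys (squarefree_exponent A) = A"
  by (auto simp: in_keys_iff lookup_squarefree_exponent split: if_splits)

text \<open>Divisibility by a squarefree monomial depends on the support alone, so a cone with such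
  a vertex consists of the exponents whose support lies in an interval.\<close>

lemma cone_squarefree_exponent:
  assumes "finite A" "A \<subseteq> B"
  shows "cone (squarefree_exponent A) B = {e. A \<subseteq> Poly_Mapping.keys e \<and> Poly_Mapping.keys e \<subseteq> B}"
proof (intro equalityI subsetI)
  fix e assume "e \<in> cone (squarefree_exponent A) B"
  then obtain c where c: "e = c + squarefree_exponent A" "Poly_Mapping.keys c \<subseteq> B"
    by (auto simp: cone_def)
  have "Poly_Mapping.keys e = Poly_Mapping.keys c \<union> A"
    using assms(1) by (auto simp: c(1) in_keys_iff lookup_add lookup_squarefree_exponent)
  then show "e \<in> {e. A \<subseteq> Poly_Mapping.keys e \<and> Poly_Mapping.keys e \<subseteq> B}"
    using c(2) assms(2) by simp
next
  fix e :: "nat \<Rightarrow>\<^sub>0 nat"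
  assume e: "e \<in> {e. A \<subseteq> Poly_Mapping.keys e \<and> Poly_Mapping.keys e \<subseteq> B}"
  let ?c = "e - squarefree_exponent A"
  have "e = ?c + squarefree_exponent A"
    using e assms(1) by (intro poly_mapping_eqI)
      (auto simp: lookup_add lookup_minus lookup_squarefree_exponent in_keys_iff subset_iff Suc_le_eq)
  moreover have "Poly_Mapping.keys ?c \<subseteq> B"
    using e by (auto simp: in_keys_iff lookup_minus subset_iff)
  ultimately show "e \<in> cone (squarefree_exponent A) B" by (auto simp only: cone_def)
qed

text \<open>Each interval \<open>{A..B}\<close> becomes the cone with squarefree vertex
  \<open>A\<close> and directions \<open>B\<close>, so a partition of the supports becomes one of
  \<open>\<Omega>\<close>.\<close>

lemma (in monomial_subquotient) sdepth_ge_of_interval_partition: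
  assumes G: "interval_partition \<S> G" and "\<S> \<noteq> {}" and \<S>: "\<And>T. T \<in> \<S> \<Longrightarrow> T \<subseteq> {1..p}"
    and \<Omega>: "\<Omega> = {e. Poly_Mapping.keys e \<in> \<S>}"
    and d: "\<And>A B. (A, B) \<in> G \<Longrightarrow> d \<le> card B"
  shows "\<exists>D. stanley_decomposition D" and "d \<le> sdepth"
proof -
  note G = interval_partitionD[OF G]
  \<comment> \<open>Distinctness turns the unique interval into a unique list index.\<close>
  obtain Is where Is: "set Is = G" "distinct Is"
    using finite_distinct_list[OF G(1)] by blast
  let ?bs = "map (\<lambda>(A, B). (squarefree_exponent A, B)) Is"
  have nth: "?bs ! i = (squarefree_exponent (fst (Is ! i)), snd (Is ! i))" if "i < length Is" for i
    using that by (simp add: case_prod_beta)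
  have I: "(fst (Is ! i), snd (Is ! i)) \<in> G" if "i < length Is" for i
    using that Is(1) by auto
  have B: "snd (Is ! i) \<subseteq> {1..p}" if "i < length Is" for i
    using G(2,3)[OF I[OF that]] \<S> by blast
  have cone: "cone (fst (?bs ! i)) (snd (?bs ! i)) = {e. Poly_Mapping.keys e \<in> {fst (Is ! i)..snd (Is ! i)}}"
    if "i < length Is" for i
  proof -
    have "finite (fst (Is ! i))"
      using G(2)[OF I[OF that]] B[OF that] by (meson finite_atLeastAtMost finite_subset)
    then show ?thesis
      using cone_squarefree_exponent[OF _ G(2)[OF I[OF that]]] by (simp add: nth[OF that] del: nth_map)
  qed
  have 1: "snd (?bs ! i) \<subseteq> {1..p}" if "i < length ?bs" for i
    using B that by (simp add: case_prod_beta)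
  have 2: "cone (fst (?bs ! i)) (snd (?bs ! i)) \<subseteq> \<Omega>" if "i < length ?bs" for i
    using that G(3)[OF I] cone[of i] by (auto simp: \<Omega> simp del: nth_map)
  have 3: "\<exists>!i. i < length ?bs \<and> e \<in> cone (fst (?bs ! i)) (snd (?bs ! i))" if "e \<in> \<Omega>" for e
  proof -
    have "\<exists>!I. I \<in> G \<and> Poly_Mapping.keys e \<in> {fst I..snd I}"
      using that by (intro G(4)) (simp add: \<Omega>)
    then obtain L where L: "L \<in> G \<and> Poly_Mapping.keys e \<in> {fst L..snd L}"
      "\<forall>L'. L' \<in> G \<and> Poly_Mapping.keys e \<in> {fst L'..snd L'} \<longrightarrow> L' = L" by (rule ex1E)
    obtain i where i: "i < length Is" "Is ! i = L" using L(1) Is(1) by (metis in_set_conv_nth)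
    show ?thesis
    proof (rule ex1I[of _ i])
      show "i < length ?bs \<and> e \<in> cone (fst (?bs ! i)) (snd (?bs ! i))"
        using i L(1) cone[OF i(1)] by (simp del: nth_map)
      fix j assume j: "j < length ?bs \<and> e \<in> cone (fst (?bs ! j)) (snd (?bs ! j))"
      then have "j < length Is" by simp
      then have "Is ! j \<in> G" "Poly_Mapping.keys e \<in> {fst (Is ! j)..snd (Is ! j)}"
        using I j cone[of j] by (simp_all del: nth_map)
      then have "Is ! j = Is ! i" using L(2) i(2) by blast
      then show "j = i" using Is(2) \<open>j < length Is\<close> i(1) nth_eq_iff_index_eq by blast
    qed
  qed
  have 4: "d \<le> card (snd (?bs ! i))" if "i < length ?bs" for i
    using d[OF I] that by (simp add: case_prod_beta)
  obtain T where T: "T \<in> \<S>" using assms(2) by blast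
  then have "finite T" using \<S> finite_subset by blast
  with T have "squarefree_exponent T \<in> \<Omega>" by (simp add: \<Omega> keys_squarefree_exponent)
  then have 0: "\<Omega> \<noteq> {}" by blast
  show "\<exists>D. stanley_decomposition D" by (rule sdepth_ge(1)[OF 0 1 2 3 4])
  show "d \<le> sdepth" by (rule sdepth_ge(2)[OF 0 1 2 3 4])
qed

section \<open>Monomial ideals and their quotients\<close>

declare One_nat_def [simp del]

text \<open>The smaller ideal is \<open>0\<close>, so \<open>\<Omega>\<close> equals
  \<open>J\<close>.\<close>

lemma (in multigraded_ideal) monomial_subquotient_ideal_module:
  assumes I: "I = monomial_span J"
  shows "monomial_subquotient p (ideal_module (poly_ring {1..p}) I) (ideal_component I) J J (\<lambda>f. f)"
proof -
  interpret M: multigraded_module p "ideal_module (poly_ring {1..p}) I" "ideal_component I"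
    by (rule ideal_module_multigraded)
  have single: "Poly_Mapping.single b (1::'k) \<in> I \<longleftrightarrow> b \<in> J" for b
    by (simp add: I)
  show ?thesis
  proof unfold_locales
    fix b assume b: "b \<in> J"
    then have "Poly_Mapping.single b (1::'k) \<in> carrier (poly_ring {1..p})"
      using single I_subset by blast
    then show "Poly_Mapping.keys b \<subseteq> {1..p}" by (simp add: carrier_poly_ring)
    fix c :: "nat \<Rightarrow>\<^sub>0 nat" assume "Poly_Mapping.keys c \<subseteq> {1..p}"
    then have "Poly_Mapping.single c (1::'k) \<in> carrier (poly_ring {1..p})"
      by (simp add: carrier_poly_ring)
    then have "Poly_Mapping.single c (1::'k) * Poly_Mapping.single b 1 \<in> I"
      using b single I_mult by blast
    then show "c + b \<in> J" by (simp add: mult_single single)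
  next
    fix f :: "'k mpoly" assume "f \<in> monomial_span J"
    then have "Poly_Mapping.keys f \<inter> J = Poly_Mapping.keys f" by (auto simp: monomial_span_def)
    then show "f = \<zero>\<^bsub>ideal_module (poly_ring {1..p}) I\<^esub> \<longleftrightarrow> Poly_Mapping.keys f \<inter> J = {}"
      by (simp add: ideal_module_def)
  qed (auto simp: ideal_module_def ideal_component_def I)
qed

text \<open>The larger ideal is the whole ring, and \<open>\<Omega>\<close> consists of the
  monomials outside \<open>I\<close>.\<close>

lemma (in multigraded_ideal) monomial_subquotient_quotient_module:
  assumes I: "I = monomial_span J"
  shows "monomial_subquotient p (quotient_module (poly_ring {1..p}) I) (quotient_component p I)
    {b. Poly_Mapping.keys b \<subseteq> {1..p}} ({b. Poly_Mapping.keys b \<subseteq> {1..p}} - J)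
    (\<lambda>f. I +>\<^bsub>poly_ring {1..p}\<^esub> f)"
proof -
  let ?S = "poly_ring {1..p} :: 'k mpoly ring"
  let ?M = "quotient_module ?S I"
  let ?c = "\<lambda>f. I +>\<^bsub>?S\<^esub> f"
  let ?E = "{b. Poly_Mapping.keys b \<subseteq> {1..p}}"
  interpret M: multigraded_module p ?M "quotient_component p I"
    by (rule quotient_module_multigraded)
  have S: "monomial_span ?E = carrier ?S"
    by (rule Set.set_eqI) (unfold carrier_poly_ring monomial_span_def, blast)
  have carrier: "carrier ?M = ?c ` carrier ?S" "\<zero>\<^bsub>?M\<^esub> = I"
    by (auto simp: quotient_module_def FactRing_def A_RCOSETS_def' a_r_coset_def')
  have add: "?c (f + g) = ?c f \<oplus>\<^bsub>?M\<^esub> ?c g" if "f \<in> carrier ?S" "g \<in> carrier ?S" for f g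
    using a_rcos_sum[OF that] by (simp add: quotient_module_def FactRing_def)
  have smult: "f \<odot>\<^bsub>?M\<^esub> ?c g = ?c (f * g)" if "f \<in> carrier ?S" "g \<in> carrier ?S" for f g
    using rcoset_mult_add[OF that] by (simp add: quotient_module_def FactRing_def)
  have zero: "?c f = I \<longleftrightarrow> f \<in> I" if "f \<in> carrier ?S" for f
    using a_rcos_const a_rcos_self[OF that] by blast
  show ?thesis
  proof unfold_locales
    fix b c :: "nat \<Rightarrow>\<^sub>0 nat" assume "b \<in> ?E" "Poly_Mapping.keys c \<subseteq> {1..p}"
    then show "c + b \<in> ?E" using keys_add[of c b] by blast
  next
    fix x assume "x \<in> carrier ?M"
    then obtain f where f: "f \<in> carrier ?S" "x = ?c f" by (auto simp: carrier)
    \<comment> \<open>Removing the terms that lie in \<open>I\<close> does not change the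
      coset.\<close>
    define g where "g = truncate (?E - J) f"
    have g: "g \<in> monomial_span (?E - J)" unfolding g_def by (rule truncate_in_span)
    then have gS: "g \<in> carrier ?S" using monomial_span_mono[of "?E - J" ?E] S by blast
    have "f \<in> monomial_span ?E" using f(1) S by simp
    then have "f - g \<in> I" by (auto simp: I g_def monomial_span_iff lookup_minus lookup_truncate)
    then have "?c (g + (f - g)) = ?c g \<oplus>\<^bsub>?M\<^esub> \<zero>\<^bsub>?M\<^esub>"
      using add[OF gS, of "f - g"] zero[of "f - g"] I_subset by (auto simp: carrier(2))
    also have "\<dots> = ?c g" using gS by (intro M.M.r_zero) (auto simp: carrier(1))
    finally show "\<exists>f\<in>monomial_span (?E - J). x = ?c f" using f(2) g by auto
  next
    fix f :: "'k mpoly" assume f: "f \<in> monomial_span ?E"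
    then have "?c f = \<zero>\<^bsub>?M\<^esub> \<longleftrightarrow> f \<in> I" using zero carrier(2) S by auto
    also have "\<dots> \<longleftrightarrow> Poly_Mapping.keys f \<inter> (?E - J) = {}"
      using f by (auto simp: I monomial_span_def)
    finally show "?c f = \<zero>\<^bsub>?M\<^esub> \<longleftrightarrow> Poly_Mapping.keys f \<inter> (?E - J) = {}" .
  next
    fix a assume "a \<in> degrees p"
    then have "monomial_span ?E \<inter> poly_component a = (poly_component a :: 'k mpoly set)"
      using poly_component_subset S by blast
    then show "quotient_component p I a = ?c ` (monomial_span ?E \<inter> poly_component a)"
      by (simp add: quotient_component_def)
  qed (auto simp: S carrier add smult)
qed

declare One_nat_def [simp]

section \<open>Bounds for the intersection of two monomial primes\<close>

lemma cone_add_single: "e \<in> cone b Z \<Longrightarrow> z \<in> Z \<Longrightarrow> e + Poly_Mapping.single z 1 \<in> cone b Z"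
proof -
  assume "e \<in> cone b Z" "z \<in> Z"
  then obtain c where "e = c + b" "Poly_Mapping.keys c \<subseteq> Z" by (auto simp: cone_def)
  then have "e + Poly_Mapping.single z 1 = (c + Poly_Mapping.single z 1) + b"
    "Poly_Mapping.keys (c + Poly_Mapping.single z 1) \<subseteq> Z"
    using \<open>z \<in> Z\<close> keys_add[of c "Poly_Mapping.single z 1"] by (auto simp: add_ac)
  then show ?thesis by (auto simp only: cone_def)
qed

lemma lookup_base_le: "e \<in> cone b Z \<Longrightarrow> Poly_Mapping.lookup b i \<le> Poly_Mapping.lookup e i"
  by (auto simp: cone_def lookup_add)

text \<open>The part of \<open>R\<close> off the diagonal, its converse and the diagonal are
  pairwise disjoint in \<open>X \<times> X\<close>; at most \<open>card X\<close> pairs of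
  \<open>R\<close> are diagonal.\<close>

lemma card_antisym_le:
  assumes "finite X" "R \<subseteq> X \<times> X" "antisym R"
  shows "2 * card R \<le> card X * (card X + 1)"
proof -
  let ?D = "R - Id"
  have fin: "finite R" using assms(1,2) finite_subset by blast
  have "?D \<inter> ?D\<inverse> = {}" using assms(3) by (auto dest: antisymD)
  moreover have "finite (?D\<inverse>)" using fin by (simp only: finite_converse finite_Diff)
  ultimately have "card (?D \<union> ?D\<inverse>) = 2 * card ?D"
    using fin by (subst card_Un_disjoint) (simp_all add: card_inverse)
  moreover have "(?D \<union> ?D\<inverse>) \<inter> Id_on X = {}" by auto
  moreover have "(?D \<union> ?D\<inverse>) \<union> Id_on X \<subseteq> X \<times> X" using assms(2) by auto
  moreover have "card (Id_on X) = card X" "finite (Id_on X)"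
    using assms(1) by (simp_all add: Id_on_def card_UN_disjoint)
  ultimately have "2 * card ?D + card X \<le> card X * card X"
    using card_mono[of "X \<times> X" "(?D \<union> ?D\<inverse>) \<union> Id_on X"] card_Un_disjoint[of "?D \<union> ?D\<inverse>" "Id_on X"]
      assms(1) fin \<open>finite (?D\<inverse>)\<close> by (simp add: card_cartesian_product)
  moreover have "card R \<le> card ?D + card X"
  proof -
    have "R \<subseteq> ?D \<union> Id_on X" using assms(2) by auto
    then have "card R \<le> card (?D \<union> Id_on X)"
      using fin \<open>finite (Id_on X)\<close> by (intro card_mono) auto
    also have "\<dots> \<le> card ?D + card (Id_on X)" by (rule card_Un_le)
    finally show ?thesis using \<open>card (Id_on X) = card X\<close> by simp
  qed
  ultimately show ?thesis by (simp add: algebra_simps)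
qed

text \<open>The directions in \<open>X\<close> of the cones at the monomials \<open>x y\<close>, for
  fixed \<open>y\<close>, are counted twice. Each cone has at least \<open>d - card Y\<close> of
  them, while antisymmetry bounds their total by \<open>card X * (card X + 1) / 2\<close>.\<close>

lemma cone_partition_bound:
  fixes b :: "nat \<Rightarrow> nat \<Rightarrow>\<^sub>0 nat"
  assumes fin: "finite X" "finite Y" and ne: "X \<noteq> {}" "Y \<noteq> {}" and disj: "X \<inter> Y = {}"
    and \<Omega>: "\<Omega> = {e. Poly_Mapping.keys e \<subseteq> X \<union> Y \<and> Poly_Mapping.keys e \<inter> X \<noteq> {} \<and> Poly_Mapping.keys e \<inter> Y \<noteq> {}}"
    and sub: "\<And>i. i < r \<Longrightarrow> cone (b i) (Z i) \<subseteq> \<Omega>"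
    and partition: "\<And>e. e \<in> \<Omega> \<Longrightarrow> \<exists>!i. i < r \<and> e \<in> cone (b i) (Z i)"
    and d: "\<And>i. i < r \<Longrightarrow> d \<le> card (Z i)"
  shows "2 * d \<le> 2 * card Y + card X + 1"
proof -
  obtain y where y: "y \<in> Y" using ne(2) by blast
  define e where "e x = Poly_Mapping.single x 1 + Poly_Mapping.single y (1::nat)" for x
  have lookup_e: "Poly_Mapping.lookup (e x) z = (if z = x then 1 else 0) + (if z = y then 1 else 0)" for x z
    by (simp add: e_def lookup_add lookup_single when_def)
  have e\<Omega>: "e x \<in> \<Omega>" if "x \<in> X" for x
  proof -
    have "Poly_Mapping.keys (e x) = {x, y}"
      by (intro Set.set_eqI) (simp add: in_keys_iff lookup_e)
    then show ?thesis
      unfolding \<Omega> mem_Collect_eq using that y by (simp only:) blast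
  qed
  have "\<forall>x\<in>X. \<exists>i. i < r \<and> e x \<in> cone (b i) (Z i)"
    using partition e\<Omega> by blast
  from bchoice[OF this] obtain \<iota> where \<iota>: "\<And>x. x \<in> X \<Longrightarrow> \<iota> x < r \<and> e x \<in> cone (b (\<iota> x)) (Z (\<iota> x))"
    by blast
  \<comment> \<open>Each direction divides some monomial of the cone, whose support lies in
    \<open>X \<union> Y\<close>.\<close>
  have Z: "Z i \<subseteq> X \<union> Y" if "i < r" for i
  proof
    fix z assume "z \<in> Z i"
    then have "b i + Poly_Mapping.single z 1 \<in> \<Omega>"
      using sub[OF that] cone_add_single[OF base_in_cone] by blast
    moreover have "z \<in> Poly_Mapping.keys (b i + Poly_Mapping.single z 1)"
      by (simp add: in_keys_iff lookup_add)
    ultimately show "z \<in> X \<union> Y" by (auto simp: \<Omega>)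
  qed
  \<comment> \<open>A pair \<open>(x, x')\<close> records that \<open>x'\<close> is a direction of
    the cone containing \<open>x y\<close>.\<close>
  define R where "R = (SIGMA x:X. Z (\<iota> x) \<inter> X)"
  have "antisym R"
  proof (rule antisymI, rule ccontr)
    fix x x' assume R: "(x, x') \<in> R" "(x', x) \<in> R" and "x \<noteq> x'"
    then have x: "x \<in> X" "x' \<in> X" "x' \<in> Z (\<iota> x)" "x \<in> Z (\<iota> x')" by (auto simp: R_def)
    \<comment> \<open>The monomial \<open>x x' y\<close> is reached from both \<open>x y\<close> and
      \<open>x' y\<close>, so the two cones coincide.\<close>
    let ?f = "e x + Poly_Mapping.single x' 1"
    have f: "?f \<in> cone (b (\<iota> x)) (Z (\<iota> x))" using \<iota>[OF x(1)] x(3) by (intro cone_add_single) auto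
    have "?f = e x' + Poly_Mapping.single x 1" by (simp add: e_def add_ac)
    then have f': "?f \<in> cone (b (\<iota> x')) (Z (\<iota> x'))"
      using \<iota>[OF x(2)] x(4) cone_add_single by metis
    have "\<iota> x' = \<iota> x"
      using partition[of ?f] sub[of "\<iota> x"] \<iota>[OF x(1)] \<iota>[OF x(2)] f f' by blast
    then have le: "Poly_Mapping.lookup (b (\<iota> x)) z \<le> Poly_Mapping.lookup (e x) z"
      "Poly_Mapping.lookup (b (\<iota> x)) z \<le> Poly_Mapping.lookup (e x') z" for z
      using lookup_base_le \<iota>[OF x(1)] \<iota>[OF x(2)] by metis+
    \<comment> \<open>The common vertex divides both \<open>x y\<close> and \<open>x' y\<close>, so
      it involves no variable of \<open>X\<close>, although every element of \<open>\<Omega>\<close>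
      does.\<close>
    have "Poly_Mapping.lookup (b (\<iota> x)) z = 0" if "z \<in> X" for z
      using le[of z] \<open>x \<noteq> x'\<close> that disj y by (auto simp: lookup_e split: if_splits)
    then have "Poly_Mapping.keys (b (\<iota> x)) \<inter> X = {}" by (auto simp: in_keys_iff)
    moreover have "b (\<iota> x) \<in> \<Omega>" using sub \<iota>[OF x(1)] base_in_cone by blast
    ultimately show False by (simp add: \<Omega>)
  qed
  then have "2 * card R \<le> card X * (card X + 1)"
    using fin by (intro card_antisym_le) (auto simp: R_def)
  moreover have "card X * (d - card Y) \<le> card R"
  proof -
    \<comment> \<open>The subtraction is truncated, which also covers the case
      \<open>d \<le> card Y\<close>.\<close>
    have "d - card Y \<le> card (Z (\<iota> x) \<inter> X)" if x: "x \<in> X" for x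
    proof -
      have "Z (\<iota> x) \<subseteq> (Z (\<iota> x) \<inter> X) \<union> Y" using Z \<iota>[OF x] by blast
      then have "card (Z (\<iota> x)) \<le> card ((Z (\<iota> x) \<inter> X) \<union> Y)" using fin by (intro card_mono) auto
      also have "\<dots> \<le> card (Z (\<iota> x) \<inter> X) + card Y" by (rule card_Un_le)
      finally show ?thesis using d[of "\<iota> x"] \<iota>[OF x] by linarith
    qed
    then have "(\<Sum>x\<in>X. d - card Y) \<le> (\<Sum>x\<in>X. card (Z (\<iota> x) \<inter> X))" by (intro sum_mono)
    also have "\<dots> = card R" using fin by (simp add: R_def)
    finally show ?thesis by simp
  qed
  ultimately have "card X * (2 * (d - card Y)) \<le> card X * (card X + 1)" by linarith
  moreover have "card X > 0" using fin ne by (simp add: card_gt_0_iff)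
  ultimately have "2 * (d - card Y) \<le> card X + 1" by (simp only: mult_le_cancel1)
  then show ?thesis by linarith
qed

text \<open>This moves the remaining arithmetic to natural numbers.\<close>

lemma ceiling_half: "\<lceil>real n / 2\<rceil> = int ((n + 1) div 2)"
proof (rule ceiling_unique)
  have "2 * ((n + 1) div 2) \<le> n + 1" "n \<le> 2 * ((n + 1) div 2)" by presburger+
  then have "real (2 * ((n + 1) div 2)) \<le> real (n + 1)" "real n \<le> real (2 * ((n + 1) div 2))"
    by (simp_all only: of_nat_le_iff)
  then show "real_of_int (int ((n + 1) div 2)) - 1 < real n / 2"
    "real n / 2 \<le> real_of_int (int ((n + 1) div 2))" by simp_all
qed

theorem proposition2p2:
  fixes n m :: nat
    and S :: "'k::field mpoly ring"
    and I :: "'k mpoly set"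
    and sdepth_I sdepth_SI :: nat
  assumes "n \<ge> m" and "m \<ge> 1"
    and "S = poly_ring {1..n + m}"
    and "I = genideal S (var ` {1..n}) \<inter> genideal S (var ` {n + 1..n + m})"
    and "sdepth_I =
      multigraded_module.sdepth (n + m) (ideal_module S I) (ideal_component I)"
    and "sdepth_SI =
      multigraded_module.sdepth (n + m) (quotient_module S I) (quotient_component (n + m) I)"
  shows "(int m \<ge> int sdepth_SI \<and> int sdepth_SI \<ge> min (int m) \<lceil>real n / 2\<rceil>) \<and>
    (int m + \<lceil>real n / 2\<rceil> \<ge> int sdepth_I \<and>
      int sdepth_I \<ge> \<lceil>real n / 2\<rceil> + \<lceil>real m / 2\<rceil>) \<and>
    (n \<ge> 2 * m - 1 \<longrightarrow> sdepth_SI = m)"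
proof -
  let ?p = "n + m"
  define X where "X = {1..n}"
  define Y where "Y = {n + 1..n + m}"
  have XY: "finite X" "finite Y" "X \<inter> Y = {}" "X \<union> Y = {1..?p}" "X \<noteq> {}" "Y \<noteq> {}"
      "card X = n" "card Y = m"
    using assms(1,2) by (auto simp: X_def Y_def)
  have sub: "X \<subseteq> {1..?p}" "Y \<subseteq> {1..?p}" using XY(4) by auto
  define J :: "(nat \<Rightarrow>\<^sub>0 nat) set" where
    "J = {e. Poly_Mapping.keys e \<subseteq> X \<union> Y \<and> Poly_Mapping.keys e \<inter> X \<noteq> {} \<and> Poly_Mapping.keys e \<inter> Y \<noteq> {}}"
  have I_def: "I = genideal (poly_ring {1..?p}) (var ` X) \<inter> genideal (poly_ring {1..?p}) (var ` Y)"
    using assms(3,4) by (simp add: X_def Y_def)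
  \<comment> \<open>A monomial lies in both primes exactly if its support meets both sets of
    variables.\<close>
  have I: "I = monomial_span J"
    unfolding I_def genideal_vars[OF sub(1)] genideal_vars[OF sub(2)] J_def XY(4)
    by (rule Set.set_eqI) (unfold monomial_span_def carrier_poly_ring Int_iff mem_Collect_eq, blast)
  interpret multigraded_ideal ?p I
    unfolding I_def by (intro multigraded_ideal_Int multigraded_ideal_genideal_vars sub)
  interpret I: monomial_subquotient ?p "ideal_module (poly_ring {1..?p}) I" "ideal_component I" J J "\<lambda>f. f"
    by (rule monomial_subquotient_ideal_module[OF I])
  let ?E = "{b. Poly_Mapping.keys b \<subseteq> {1..?p}}"
  interpret Q: monomial_subquotient ?p "quotient_module (poly_ring {1..?p}) I" "quotient_component ?p I"
    ?E "?E - J" "\<lambda>f. I +>\<^bsub>poly_ring {1..?p}\<^esub> f"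
    by (rule monomial_subquotient_quotient_module[OF I])
  have sdepth: "sdepth_I = I.sdepth" "sdepth_SI = Q.sdepth"
    using assms(3,5,6) by simp_all
  obtain G where G: "interval_partition {T. T \<subseteq> X \<and> T \<noteq> {}} G" "\<forall>(A, B)\<in>G. n \<le> 2 * card B"
    using interval_partition_nonempty_subsets[OF XY(1)] unfolding XY(7) by blast
  obtain H where H: "interval_partition {T. T \<subseteq> Y \<and> T \<noteq> {}} H" "\<forall>(A, B)\<in>H. m \<le> 2 * card B"
    using interval_partition_nonempty_subsets[OF XY(2)] unfolding XY(8) by blast
  have GX: "B \<subseteq> X" "(n + 1) div 2 \<le> card B" if "(A, B) \<in> G" for A B
    using interval_partitionD(2,3)[OF G(1) that] G(2) that by auto
  have HY: "B \<subseteq> Y" "(m + 1) div 2 \<le> card B" if "(A, B) \<in> H" for A B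
    using interval_partitionD(2,3)[OF H(1) that] H(2) that by auto
  have I_ge: "\<exists>D. I.stanley_decomposition D" "(n + 1) div 2 + (m + 1) div 2 \<le> I.sdepth"
  proof -
    let ?\<S> = "{T. T \<subseteq> X \<union> Y \<and> T \<inter> X \<noteq> {} \<and> T \<inter> Y \<noteq> {}}"
    let ?G = "(\<lambda>(I, K). (fst I \<union> fst K, snd I \<union> snd K)) ` (G \<times> H)"
    have 1: "?\<S> \<noteq> {}" using XY by blast
    have 2: "T \<subseteq> {1..?p}" if "T \<in> ?\<S>" for T using that XY(4) by blast
    have 3: "J = {e. Poly_Mapping.keys e \<in> ?\<S>}" by (simp add: J_def)
    have 4: "(n + 1) div 2 + (m + 1) div 2 \<le> card B" if AB: "(A, B) \<in> ?G" for A B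
    proof -
      from AB obtain I K where IK: "B = snd I \<union> snd K" "(fst I, snd I) \<in> G" "(fst K, snd K) \<in> H"
        by auto
      have fin: "finite (snd I)" "finite (snd K)"
        using GX(1)[OF IK(2)] HY(1)[OF IK(3)] XY(1,2) finite_subset by blast+
      have "snd I \<inter> snd K = {}" using GX(1)[OF IK(2)] HY(1)[OF IK(3)] XY(3) by blast
      then have "card B = card (snd I) + card (snd K)" using fin by (simp add: IK(1) card_Un_disjoint)
      then show ?thesis using GX(2)[OF IK(2)] HY(2)[OF IK(3)] by linarith
    qed
    note * = I.sdepth_ge_of_interval_partition[OF interval_partition_product[OF G(1) H(1) XY(3)] 1 2 3 4]
    show "\<exists>D. I.stanley_decomposition D" by (rule *(1))
    show "(n + 1) div 2 + (m + 1) div 2 \<le> I.sdepth" by (rule *(2))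
  qed
  have I_le: "I.sdepth \<le> m + (n + 1) div 2"
  proof (rule I.sdepth_le[OF I_ge(1)])
    fix D b
    assume D: "\<And>i. i < length D \<Longrightarrow> cone (b i) (snd (D ! i)) \<subseteq> J"
      "\<And>e. e \<in> J \<Longrightarrow> \<exists>!i. i < length D \<and> e \<in> cone (b i) (snd (D ! i))"
      "\<And>i. i < length D \<Longrightarrow> I.sdepth_decomposition D \<le> card (snd (D ! i))"
    have "2 * I.sdepth_decomposition D \<le> 2 * card Y + card X + 1"
      by (rule cone_partition_bound[OF XY(1,2,5,6,3) J_def D])
    then show "I.sdepth_decomposition D \<le> m + (n + 1) div 2" unfolding XY(7,8) by linarith
  qed
  \<comment> \<open>Within \<open>X \<union> Y\<close>, missing \<open>Y\<close> means lying in
    \<open>X\<close>, and conversely.\<close>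
  have E: "?E - J = {e. Poly_Mapping.keys e \<in> {T. T \<subseteq> X \<or> T \<subseteq> Y}}"
    unfolding J_def XY(4)[symmetric] using XY(3) by blast
  have Q_ge: "\<exists>D. Q.stanley_decomposition D" "min m ((n + 1) div 2) \<le> Q.sdepth"
  proof -
    let ?\<S> = "{T. T \<subseteq> X \<or> T \<subseteq> Y}"
    have 1: "?\<S> \<noteq> {}" by blast
    have 2: "T \<subseteq> {1..?p}" if "T \<in> ?\<S>" for T using that sub by blast
    \<comment> \<open>The cube over \<open>Y\<close> contributes \<open>m\<close>, the intervals
      over \<open>X\<close> contribute half of \<open>n\<close> rounded up.\<close>
    have 3: "min m ((n + 1) div 2) \<le> card B" if "(A, B) \<in> insert ({}, Y) G" for A B
      using that GX(2)[of A B] XY(8) by (auto simp: min_le_iff_disj)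
    note * = Q.sdepth_ge_of_interval_partition[OF interval_partition_insert_cube[OF G(1) XY(3)] 1 2 E 3]
    show "\<exists>D. Q.stanley_decomposition D" by (rule *(1))
    show "min m ((n + 1) div 2) \<le> Q.sdepth" by (rule *(2))
  qed
  have Q_le: "Q.sdepth \<le> m"
  proof (rule Q.sdepth_le[OF Q_ge(1)])
    fix D b
    assume D: "\<And>i. i < length D \<Longrightarrow> cone (b i) (snd (D ! i)) \<subseteq> ?E - J"
      "\<And>e. e \<in> ?E - J \<Longrightarrow> \<exists>!i. i < length D \<and> e \<in> cone (b i) (snd (D ! i))"
      "\<And>i. i < length D \<Longrightarrow> Q.sdepth_decomposition D \<le> card (snd (D ! i))"
    obtain y where y: "y \<in> Y" using XY(6) by blast
    \<comment> \<open>For a direction \<open>z\<close> of the cone through this variable, the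
      monomial \<open>y z\<close> stays outside \<open>I\<close>, which forces \<open>z\<close> into
      \<open>Y\<close>.\<close>
    let ?e = "Poly_Mapping.single y 1 :: nat \<Rightarrow>\<^sub>0 nat"
    have "?e \<in> ?E - J" unfolding E using y by simp
    then obtain i where i: "i < length D" "?e \<in> cone (b i) (snd (D ! i))" using D(2) by blast
    have "snd (D ! i) \<subseteq> Y"
    proof
      fix z assume "z \<in> snd (D ! i)"
      then have "?e + Poly_Mapping.single z 1 \<in> ?E - J"
        using cone_add_single[OF i(2)] D(1)[OF i(1)] by blast
      moreover have "Poly_Mapping.keys (?e + Poly_Mapping.single z 1) = {y, z}"
        by (auto simp: in_keys_iff lookup_add lookup_single when_def split: if_splits)
      ultimately show "z \<in> Y" unfolding E using y XY(3) by auto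
    qed
    then have "card (snd (D ! i)) \<le> m" using card_mono[OF XY(2)] XY(8) by metis
    then show "Q.sdepth_decomposition D \<le> m" using D(3)[OF i(1)] by linarith
  qed
  \<comment> \<open>For the last claim, \<open>n \<ge> 2 * m - 1\<close> gives
    \<open>(n + 1) div 2 \<ge> m\<close>, so both bounds for \<open>S/I\<close> equal
    \<open>m\<close>.\<close>
  show ?thesis
    unfolding sdepth ceiling_half using I_ge(2) I_le Q_ge(2) Q_le by auto
qed

end
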